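(* Let $M$ be a connected matroid of rank at least two on a finite set $E$. Then $M$ is entropic if and only if it has a probability space representation in a discrete probability space in which each singleton has nonzero probability. In this case each of the random variables $\{X_e\}_{e\in E}$ of such a representation is uniformly distributed, and the underlying probability space can be chosen to be finite.
   Context: A matroid $M=(E,r)$ is entropic if there exist discrete random variables $\{X_e\}_{e\in E}$ on a common probability space and $\lambda>0$ with $r(A)=\lambda H(X_A)$ for all $A\subseteq E$, where $X_A=(X_e)_{e\in A}$ and $H$ is Shannon entropy. A matroid is connected if every pair of elements lies in a common circuit. A probability space representation of $M$ consists of a discrete probability space $(\Omega,\mathcal F,P)$ and random variables $X_e:\Omega\to\Omega_e$ ($e\in E$, $(\Omega_e,\mathcal F_e)$ measurable spaces) such that: (1) if $A\subseteq E$ is independent in $M$, the variables $\{X_e\}_{e\in A}$ are independent; (2) if $C$ is a circuit and $c\in C$, then $X_c$ is determined by $\{X_e\}_{e\in C\setminus\{c\}}$, i.e. there is a measurable $f:\prod_{e\in C\setminus\{c\}}\Omega_e\to\Omega_c$ with $f\circ(X_e)_{e\in C\setminus\{c\}}=X_c$; (3) if $e$ is not a loop, there are disjoint measurable $S,T\subsetneq\Omega_e$ with $X_e^{-1}(S)$ and $X_e^{-1}(T)$ of nonzero probability. *)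

theory Defs
  imports "HOL-Probability.Probability" "HOL-Library.Infinite_Typeclass"
begin

definition matroid :: "'e set \<Rightarrow> ('e set \<Rightarrow> nat) \<Rightarrow> bool" where
  "matroid E r \<longleftrightarrow>
     finite E \<and>
     (\<forall>A\<subseteq>E. r A \<le> card A) \<and>
     (\<forall>A B. A \<subseteq> B \<and> B \<subseteq> E \<longrightarrow> r A \<le> r B) \<and>
     (\<forall>A\<subseteq>E. \<forall>B\<subseteq>E. r (A \<union> B) + r (A \<inter> B) \<le> r A + r B)"

definition matroid_indep :: "'e set \<Rightarrow> ('e set \<Rightarrow> nat) \<Rightarrow> 'e set \<Rightarrow> bool" where
  "matroid_indep E r A \<longleftrightarrow> A \<subseteq> E \<and> r A = card A"

definition matroid_circuit :: "'e set \<Rightarrow> ('e set \<Rightarrow> nat) \<Rightarrow> 'e set \<Rightarrow> bool" where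
  "matroid_circuit E r C \<longleftrightarrow>
     C \<subseteq> E \<and> \<not> matroid_indep E r C \<and> (\<forall>D. D \<subset> C \<longrightarrow> matroid_indep E r D)"

definition matroid_loop :: "'e set \<Rightarrow> ('e set \<Rightarrow> nat) \<Rightarrow> 'e \<Rightarrow> bool" where
  "matroid_loop E r e \<longleftrightarrow> matroid_circuit E r {e}"

definition matroid_connected :: "'e set \<Rightarrow> ('e set \<Rightarrow> nat) \<Rightarrow> bool" where
  "matroid_connected E r \<longleftrightarrow>
     (\<forall>e\<in>E. \<forall>f\<in>E. e \<noteq> f \<longrightarrow> (\<exists>C. matroid_circuit E r C \<and> e \<in> C \<and> f \<in> C))"

definition discrete_rv :: "'w measure \<Rightarrow> ('w \<Rightarrow> 'v) \<Rightarrow> bool" where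
  "discrete_rv P X \<longleftrightarrow> X \<in> measurable P (count_space UNIV) \<and> countable (X ` space P)"

definition joint_rv :: "('e \<Rightarrow> 'w \<Rightarrow> 'v) \<Rightarrow> 'e set \<Rightarrow> 'w \<Rightarrow> 'e \<Rightarrow> 'v" where
  "joint_rv X A \<omega> = restrict (\<lambda>e. X e \<omega>) A"

text \<open>The entropy takes values in \<^typ>\<open>ennreal\<close>, since a discrete random variable with infinitely
  many values may have infinite entropy. The real-valued entropy of the theory Information is a
  Bochner integral, which would be 0 in that case.\<close>

definition shannon_entropy :: "'w measure \<Rightarrow> ('w \<Rightarrow> 'v) \<Rightarrow> ennreal" where
  "shannon_entropy P X =
     (\<integral>\<^sup>+ x. ennreal (- (measure P {\<omega>\<in>space P. X \<omega> = x} * log 2 (measure P {\<omega>\<in>space P. X \<omega> = x})))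
        \<partial>count_space (X ` space P))"

text \<open>The type arguments are the universes for the sample points and for the values of the random
  variables.\<close>

definition entropic :: "'w itself \<Rightarrow> 'v itself \<Rightarrow> 'e set \<Rightarrow> ('e set \<Rightarrow> nat) \<Rightarrow> bool" where
  "entropic _ _ E r \<longleftrightarrow>
     (\<exists>(P :: 'w measure) (X :: 'e \<Rightarrow> 'w \<Rightarrow> 'v) (l :: real).
        prob_space P \<and> (\<forall>e\<in>E. discrete_rv P (X e)) \<and> l > 0 \<and>
        (\<forall>A\<subseteq>E. of_nat (r A) = ennreal l * shannon_entropy P (joint_rv X A)))"

definition discrete_prob_space :: "'w measure \<Rightarrow> bool" where
  "discrete_prob_space P \<longleftrightarrow>
     prob_space P \<and> countable (space P) \<and> sets P = Pow (space P)"

text \<open>The measure \<open>N e\<close> only serves as the measurable space in which \<open>X e\<close> takes its values.\<close>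

definition prob_space_representation ::
    "'e set \<Rightarrow> ('e set \<Rightarrow> nat) \<Rightarrow> 'w measure \<Rightarrow> ('e \<Rightarrow> 'v measure) \<Rightarrow> ('e \<Rightarrow> 'w \<Rightarrow> 'v) \<Rightarrow> bool" where
  "prob_space_representation E r P N X \<longleftrightarrow>
     discrete_prob_space P \<and>
     (\<forall>e\<in>E. X e \<in> measurable P (N e)) \<and>
     (\<forall>A. matroid_indep E r A \<longrightarrow> prob_space.indep_vars P N X A) \<and>
     (\<forall>C c. matroid_circuit E r C \<and> c \<in> C \<longrightarrow>
        (\<exists>f \<in> measurable (PiM (C - {c}) N) (N c).
           \<forall>\<omega>\<in>space P. f (joint_rv X (C - {c}) \<omega>) = X c \<omega>)) \<and>
     (\<forall>e\<in>E. \<not> matroid_loop E r e \<longrightarrow>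
        (\<exists>S\<in>sets (N e). \<exists>T\<in>sets (N e).
           S \<subset> space (N e) \<and> T \<subset> space (N e) \<and> S \<inter> T = {} \<and>
           measure P (X e -` S \<inter> space P) \<noteq> 0 \<and> measure P (X e -` T \<inter> space P) \<noteq> 0))"

definition nonzero_singletons :: "'w measure \<Rightarrow> bool" where
  "nonzero_singletons P \<longleftrightarrow> (\<forall>\<omega>\<in>space P. measure P {\<omega>} \<noteq> 0)"

text \<open>The points that the \<open>\<sigma>\<close>-algebra of \<open>N\<close> does not separate from \<open>x\<close>. If singletons are
  measurable, this is just \<open>{x}\<close>.\<close>

definition atom_of :: "'v measure \<Rightarrow> 'v \<Rightarrow> 'v set" where
  "atom_of N x = {y \<in> space N. \<forall>S\<in>sets N. x \<in> S \<longleftrightarrow> y \<in> S}"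

lemma atom_of_eq_singleton:
  assumes "{x} \<in> sets N"
  shows "atom_of N x = {x}"
proof (intro equalityI subsetI)
  fix y assume "y \<in> atom_of N x"
  then have "\<forall>S\<in>sets N. x \<in> S \<longleftrightarrow> y \<in> S"
    by (simp add: atom_of_def)
  from bspec[OF this assms] show "y \<in> {x}"
    by simp
next
  fix y assume "y \<in> {x}"
  then show "y \<in> atom_of N x"
    using sets.sets_into_space[OF assms] by (simp add: atom_of_def)
qed

text \<open>Equidistribution of the values of \<open>X\<close>, where values that are not separated by the
  \<open>\<sigma>\<close>-algebra of \<open>N\<close> count as one value: on an arbitrary measurable space, the distribution of
  \<open>X\<close> carries no information below the atoms. The lemma below gives the elementary form for
  measurable spaces with measurable singletons.\<close>

definition uniformly_distributed :: "'w measure \<Rightarrow> 'v measure \<Rightarrow> ('w \<Rightarrow> 'v) \<Rightarrow> bool" where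
  "uniformly_distributed P N X \<longleftrightarrow>
     (let V = (\<lambda>\<omega>. atom_of N (X \<omega>)) ` space P in
        finite V \<and> V \<noteq> {} \<and>
        (\<forall>a\<in>V. measure P {\<omega>\<in>space P. X \<omega> \<in> a} = 1 / card V))"

lemma uniformly_distributed_measurable_singletons:
  assumes "\<And>x. x \<in> X ` space P \<Longrightarrow> {x} \<in> sets N"
  shows "uniformly_distributed P N X \<longleftrightarrow>
    finite (X ` space P) \<and> X ` space P \<noteq> {} \<and>
    (\<forall>x\<in>X ` space P. measure P {\<omega>\<in>space P. X \<omega> = x} = 1 / card (X ` space P))"
proof -
  have "atom_of N (X \<omega>) = {X \<omega>}" if "\<omega> \<in> space P" for \<omega>
    using assms[OF imageI[OF that]] by (rule atom_of_eq_singleton)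
  then have V: "(\<lambda>\<omega>. atom_of N (X \<omega>)) ` space P = (\<lambda>x. {x}) ` (X ` space P)"
    unfolding image_image by (rule image_cong[OF refl])
  have inj: "inj_on (\<lambda>x. {x}) (X ` space P)"
    by (rule inj_onI) (drule singleton_inject)
  show ?thesis
    unfolding uniformly_distributed_def Let_def V card_image[OF inj] finite_image_iff[OF inj] by simp
qed

end

theory Submission
  imports Defs
begin

text \<open>Pass to the joint distribution of all variables, a probability mass function on \<open>E \<rightarrow> V\<close>; for a
  representation the values are first replaced by atoms of their measurable spaces. Equality in the
  entropy inequalities turns rank identities into independence (on independent sets) and functional
  dependence (on circuits), so an entropic matroid yields the same data as a representation.
  In a circuit with at least three elements, two elements \<open>e\<close> and \<open>f\<close> determine each other once the
  remaining values are fixed, although each is independent of the rest and \<open>e\<close> of \<open>f\<close>. This forces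
  all values of \<open>X\<^sub>e\<close> and \<open>X\<^sub>f\<close> to have the same probability. By connectedness all variables are
  uniform on \<open>n\<close> values, and every value of \<open>X\<^sub>A\<close> has probability \<open>n\<close> to the power \<open>- r A\<close>. The support
  of the joint distribution is then a finite code whose uniform measure gives both structures.\<close>

subsection \<open>Matroids\<close>

lemma matroid_rank_mono: "matroid E r \<Longrightarrow> A \<subseteq> B \<Longrightarrow> B \<subseteq> E \<Longrightarrow> r A \<le> r B"
  by (simp add: matroid_def)

lemma matroid_rank_le_card: "matroid E r \<Longrightarrow> A \<subseteq> E \<Longrightarrow> r A \<le> card A"
  by (simp add: matroid_def)

lemma matroid_rank_empty: "matroid E r \<Longrightarrow> r {} = 0"
  using matroid_rank_le_card[of E r "{}"] by simp

lemma matroid_submodular: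
  "matroid E r \<Longrightarrow> A \<subseteq> E \<Longrightarrow> B \<subseteq> E \<Longrightarrow> r (A \<union> B) + r (A \<inter> B) \<le> r A + r B"
  by (simp add: matroid_def)

lemma matroid_finite_subset: "matroid E r \<Longrightarrow> A \<subseteq> E \<Longrightarrow> finite A"
  using finite_subset[of A E] by (simp add: matroid_def)

text \<open>Submodularity on \<open>B\<close> and \<open>A - B\<close> leaves no slack:
  \<open>card A\<close> is at most \<open>r B + r (A - B)\<close>, and both ranks are bounded by
  cardinalities that add up to \<open>card A\<close>.\<close>

lemma matroid_indep_mono:
  assumes M: "matroid E r" and A: "matroid_indep E r A" and BA: "B \<subseteq> A"
  shows "matroid_indep E r B"
proof -
  have AE: "A \<subseteq> E" and rA: "r A = card A"
    using A by (auto simp: matroid_indep_def)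
  have BE: "B \<subseteq> E" and DE: "A - B \<subseteq> E"
    using AE BA by auto
  have "r (B \<union> (A - B)) + r (B \<inter> (A - B)) \<le> r B + r (A - B)"
    using matroid_submodular[OF M BE DE] .
  moreover have "B \<union> (A - B) = A"
    using BA by auto
  ultimately have "card A \<le> r B + r (A - B)"
    using rA by simp
  moreover have "r (A - B) \<le> card (A - B)" "r B \<le> card B"
    using matroid_rank_le_card[OF M] BE DE by auto
  moreover have "card A = card B + card (A - B)"
    using BA matroid_finite_subset[OF M AE]
    by (metis card_Diff_subset card_mono finite_subset le_add_diff_inverse)
  ultimately show ?thesis
    using BE by (simp add: matroid_indep_def)
qed

text \<open>Elements of \<open>A\<close> are added to \<open>I\<close> one at a time. Submodularity
  for \<open>insert b I\<close> and the set reached so far, whose intersection contains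
  \<open>I\<close>, shows that no step raises the rank.\<close>

lemma matroid_rank_eq_if_spanned:
  assumes M: "matroid E r" and IA: "I \<subseteq> A" and AE: "A \<subseteq> E"
    and sp: "\<And>a. a \<in> A \<Longrightarrow> r (insert a I) \<le> r I"
  shows "r A = r I"
proof -
  have "r (I \<union> B) \<le> r I" if "finite B" "B \<subseteq> A" for B
    using that
  proof (induction B rule: finite_induct)
    case (insert b B)
    have IE: "insert b I \<subseteq> E" "I \<union> B \<subseteq> E"
      using insert.prems IA AE by auto
    have "r (insert b I \<union> (I \<union> B)) + r (insert b I \<inter> (I \<union> B)) \<le> r (insert b I) + r (I \<union> B)"
      using matroid_submodular[OF M IE] .
    moreover have "r I \<le> r (insert b I \<inter> (I \<union> B))"
      using IE by (intro matroid_rank_mono[OF M]) auto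
    moreover have "insert b I \<union> (I \<union> B) = I \<union> insert b B"
      by auto
    ultimately show ?case
      using insert sp[of b] by auto
  qed auto
  from this[of A] have "r A \<le> r I"
    using IA AE matroid_finite_subset[OF M] by (auto simp: Un_absorb1)
  with matroid_rank_mono[OF M IA AE] show ?thesis
    by simp
qed

lemma matroid_dependent_contains_circuit:
  assumes M: "matroid E r" and AE: "A \<subseteq> E" and dep: "\<not> matroid_indep E r A"
  obtains C where "C \<subseteq> A" "matroid_circuit E r C"
proof -
  define \<D> where "\<D> = {C. C \<subseteq> A \<and> \<not> matroid_indep E r C}"
  have "finite \<D>"
    unfolding \<D>_def using matroid_finite_subset[OF M AE] by simp
  moreover have "A \<in> \<D>"
    unfolding \<D>_def using dep by simp
  ultimately obtain C where C: "C \<in> \<D>" "\<forall>D\<in>\<D>. D \<subseteq> C \<longrightarrow> C = D"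
    using finite_has_minimal2[of \<D> A] by auto
  have "matroid_indep E r D" if "D \<subset> C" for D
    using that C unfolding \<D>_def by auto
  then have "matroid_circuit E r C"
    using C(1) AE unfolding matroid_circuit_def \<D>_def by auto
  with C(1) show thesis
    using that unfolding \<D>_def by auto
qed

text \<open>A maximal independent subset of \<open>A\<close> serves as \<open>I\<close>. The last
  conclusion provides fundamental circuits, through which functional dependence later spreads from
  \<open>I\<close> to all of \<open>A\<close>.\<close>

lemma matroid_basis_exists:
  assumes M: "matroid E r" and AE: "A \<subseteq> E"
  obtains I where "I \<subseteq> A" "matroid_indep E r I" "card I = r A"
    "\<And>a. a \<in> A - I \<Longrightarrow> \<exists>C. matroid_circuit E r C \<and> C \<subseteq> insert a I \<and> a \<in> C"
proof -
  define \<I> where "\<I> = {I. I \<subseteq> A \<and> matroid_indep E r I}"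
  have "finite \<I>"
    unfolding \<I>_def using matroid_finite_subset[OF M AE] by simp
  moreover have "{} \<in> \<I>"
    unfolding \<I>_def using matroid_rank_empty[OF M] by (simp add: matroid_indep_def)
  ultimately obtain I where I: "I \<in> \<I>" "\<forall>J\<in>\<I>. I \<subseteq> J \<longrightarrow> I = J"
    using finite_has_maximal2[of \<I> "{}"] by auto
  have IA: "I \<subseteq> A" and Iind: "matroid_indep E r I"
    using I(1) unfolding \<I>_def by auto
  have dep: "\<not> matroid_indep E r (insert a I)" if "a \<in> A - I" for a
  proof
    assume "matroid_indep E r (insert a I)"
    then have "insert a I \<in> \<I>"
      using that IA unfolding \<I>_def by simp
    then have "I = insert a I"
      using I(2) by auto
    with that show False
      by auto
  qed
  have finI: "finite I"
    using IA AE matroid_finite_subset[OF M] by auto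
  have circ: "\<exists>C. matroid_circuit E r C \<and> C \<subseteq> insert a I \<and> a \<in> C" if a: "a \<in> A - I" for a
  proof -
    have "insert a I \<subseteq> E"
      using a IA AE by auto
    then obtain C where C: "C \<subseteq> insert a I" "matroid_circuit E r C"
      using matroid_dependent_contains_circuit[OF M _ dep[OF a]] by metis
    moreover have "a \<in> C"
    proof (rule ccontr)
      assume "a \<notin> C"
      then have "matroid_indep E r C"
        using C matroid_indep_mono[OF M Iind] by (simp add: subset_insert)
      then show False
        using C by (auto simp: matroid_circuit_def)
    qed
    ultimately show ?thesis
      by blast
  qed
  have "r A = r I"
  proof (rule matroid_rank_eq_if_spanned[OF M _ AE])
    show "I \<subseteq> A"
      by (fact IA)
    fix a assume a: "a \<in> A"
    show "r (insert a I) \<le> r I"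
    proof (cases "a \<in> I")
      case False
      have "insert a I \<subseteq> E"
        using a IA AE by auto
      moreover have "r (insert a I) \<noteq> card (insert a I)"
        using dep[of a] a False calculation by (auto simp: matroid_indep_def)
      moreover have "card (insert a I) = Suc (card I)"
        using False finI by simp
      ultimately show ?thesis
        using matroid_rank_le_card[OF M, of "insert a I"] Iind by (auto simp: matroid_indep_def)
    qed (simp add: insert_absorb)
  qed
  then show thesis
    using IA Iind circ by (intro that[of I]) (auto simp: matroid_indep_def)
qed

text \<open>The rank of \<open>C\<close> lies between \<open>card C - 1\<close> and
  \<open>card C\<close>, and dependence excludes the upper value.\<close>

lemma matroid_circuit_rank:
  assumes M: "matroid E r" and C: "matroid_circuit E r C" and c: "c \<in> C"
  shows "r C = r (C - {c})"
proof -
  have CE: "C \<subseteq> E" and fin: "finite C"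
    using C M matroid_finite_subset by (auto simp: matroid_circuit_def)
  have "matroid_indep E r (C - {c})"
    using C c by (auto simp: matroid_circuit_def)
  then have "r (C - {c}) = card C - 1"
    using c fin by (simp add: matroid_indep_def)
  moreover have "r C \<noteq> card C"
    using C by (auto simp: matroid_circuit_def matroid_indep_def)
  moreover have "r C \<le> card C" "r (C - {c}) \<le> r C"
    using matroid_rank_le_card[OF M CE] matroid_rank_mono[OF M _ CE] by auto
  ultimately show ?thesis
    by linarith
qed

section \<open>Connected matroids of rank at least two\<close>

lemma connected_matroid_singleton_indep:
  assumes M: "matroid E r" and conn: "matroid_connected E r" and r2: "r E \<ge> 2" and e: "e \<in> E"
  shows "matroid_indep E r {e}"
proof -
  \<comment> \<open>Rank two forces a second element; a circuit through both has \<open>{e}\<close>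
    as a proper subset.\<close>
  have "\<not> E \<subseteq> {e}"
    using r2 matroid_rank_le_card[OF M, of E] card_mono[of "{e}" E] by auto
  then obtain f where f: "f \<in> E" "f \<noteq> e"
    by auto
  then obtain C where "matroid_circuit E r C" "e \<in> C" "f \<in> C"
    using conn e unfolding matroid_connected_def by metis
  then show ?thesis
    using f by (auto simp: matroid_circuit_def)
qed

text \<open>Some \<open>f\<close> lies outside the closure of \<open>{e}\<close>, since otherwise
  \<open>E\<close> would have rank one. Then \<open>{e, f}\<close> is independent, and a circuit
  through \<open>e\<close> and \<open>f\<close> must be larger.\<close>

lemma connected_matroid_large_circuit:
  assumes M: "matroid E r" and conn: "matroid_connected E r" and r2: "r E \<ge> 2" and e: "e \<in> E"
  obtains f C where "matroid_circuit E r C" "e \<in> C" "f \<in> C" "e \<noteq> f" "C \<noteq> {e, f}"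
proof -
  have re: "r {e} = 1"
    using connected_matroid_singleton_indep[OF assms] by (simp add: matroid_indep_def)
  have "\<exists>f\<in>E. \<not> r (insert f {e}) \<le> r {e}"
    using matroid_rank_eq_if_spanned[OF M, of "{e}" E] e r2 re by fastforce
  then obtain f where f: "f \<in> E" "\<not> r {f, e} \<le> 1"
    using re by auto
  then have "f \<noteq> e"
    using re by auto
  then obtain C where C: "matroid_circuit E r C" "e \<in> C" "f \<in> C"
    using conn e f unfolding matroid_connected_def by metis
  have "card {e, f} = 2"
    using \<open>f \<noteq> e\<close> by simp
  then have "matroid_indep E r {e, f}"
    using f e matroid_rank_le_card[OF M, of "{e, f}"] by (auto simp: matroid_indep_def insert_commute)
  then have "C \<noteq> {e, f}"
    using C by (auto simp: matroid_circuit_def)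
  with C \<open>f \<noteq> e\<close> show thesis
    using that by auto
qed

subsection \<open>Uniformity of representations of connected matroids\<close>

definition cylinder :: "'e set \<Rightarrow> ('e \<Rightarrow> 'v) \<Rightarrow> ('e \<Rightarrow> 'v) set" where
  "cylinder A x = {y. \<forall>e\<in>A. y e = x e}"

text \<open>Independence is demanded one element at a time, with \<open>x\<close> and
  \<open>y\<close> ranging separately over the support, so that values not yet known to occur
  together are covered. Dependence on a circuit is a relation between support points, with no
  function named. The last clause makes the variable at every element nonconstant, as fits a matroid
  without loops.\<close>

definition pmf_representation :: "'e set \<Rightarrow> ('e set \<Rightarrow> nat) \<Rightarrow> ('e \<Rightarrow> 'v) pmf \<Rightarrow> bool" where
  "pmf_representation E r p \<longleftrightarrow>
     (\<forall>A e. matroid_indep E r (insert e A) \<and> e \<notin> A \<longrightarrow>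
        (\<forall>x\<in>set_pmf p. \<forall>y\<in>set_pmf p. measure_pmf.prob p (cylinder A x \<inter> cylinder {e} y) =
           measure_pmf.prob p (cylinder A x) * measure_pmf.prob p (cylinder {e} y))) \<and>
     (\<forall>C c. matroid_circuit E r C \<and> c \<in> C \<longrightarrow>
        (\<forall>x\<in>set_pmf p. \<forall>y\<in>set_pmf p. y \<in> cylinder (C - {c}) x \<longrightarrow> y c = x c)) \<and>
     (\<forall>e\<in>E. \<exists>x\<in>set_pmf p. \<exists>y\<in>set_pmf p. x e \<noteq> y e)"

text \<open>The number \<open>n\<close> is the common alphabet size. The variables in
  \<open>A\<close> then have joint entropy \<open>r A * log 2 n\<close>, and
  \<open>2 \<le> n\<close> keeps the logarithm positive.\<close>

definition pmf_uniform_model :: "'e set \<Rightarrow> ('e set \<Rightarrow> nat) \<Rightarrow> nat \<Rightarrow> ('e \<Rightarrow> 'v) pmf \<Rightarrow> bool" where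
  "pmf_uniform_model E r n p \<longleftrightarrow>
     2 \<le> n \<and> (\<forall>A\<subseteq>E. \<forall>x\<in>set_pmf p. measure_pmf.prob p (cylinder A x) = 1 / real n ^ r A)"

lemma pmf_representationI:
  assumes "\<And>A e x y. matroid_indep E r (insert e A) \<Longrightarrow> e \<notin> A \<Longrightarrow> x \<in> set_pmf p \<Longrightarrow> y \<in> set_pmf p \<Longrightarrow>
      measure_pmf.prob p (cylinder A x \<inter> cylinder {e} y) =
      measure_pmf.prob p (cylinder A x) * measure_pmf.prob p (cylinder {e} y)"
    and "\<And>C c x y. matroid_circuit E r C \<Longrightarrow> c \<in> C \<Longrightarrow> x \<in> set_pmf p \<Longrightarrow> y \<in> set_pmf p \<Longrightarrow>
      y \<in> cylinder (C - {c}) x \<Longrightarrow> y c = x c"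
    and "\<And>e. e \<in> E \<Longrightarrow> \<exists>x\<in>set_pmf p. \<exists>y\<in>set_pmf p. x e \<noteq> y e"
  shows "pmf_representation E r p"
  unfolding pmf_representation_def
proof (intro conjI allI impI ballI)
  fix C c x y assume "matroid_circuit E r C \<and> c \<in> C" "x \<in> set_pmf p" "y \<in> set_pmf p" "y \<in> cylinder (C - {c}) x"
  then show "y c = x c"
    using assms(2)[of C c x y] by simp
qed (use assms(1,3) in simp_all)

lemma pmf_representation_indep:
  assumes "pmf_representation E r p" "matroid_indep E r (insert e A)" "e \<notin> A" "x \<in> set_pmf p" "y \<in> set_pmf p"
  shows "measure_pmf.prob p (cylinder A x \<inter> cylinder {e} y) =
    measure_pmf.prob p (cylinder A x) * measure_pmf.prob p (cylinder {e} y)"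
  using assms by (simp add: pmf_representation_def)

lemma pmf_representation_determined:
  assumes "pmf_representation E r p" "matroid_circuit E r C" "c \<in> C" "x \<in> set_pmf p" "y \<in> set_pmf p"
    and "y \<in> cylinder (C - {c}) x"
  shows "y c = x c"
proof -
  have "\<forall>C c. matroid_circuit E r C \<and> c \<in> C \<longrightarrow>
      (\<forall>x\<in>set_pmf p. \<forall>y\<in>set_pmf p. y \<in> cylinder (C - {c}) x \<longrightarrow> y c = x c)"
    using assms(1) by (simp add: pmf_representation_def)
  with assms(2-) show ?thesis
    by metis
qed

lemma measure_pmf_cong_support:
  assumes "\<And>x. x \<in> set_pmf p \<Longrightarrow> x \<in> A \<longleftrightarrow> x \<in> B"
  shows "measure_pmf.prob p A = measure_pmf.prob p B"
proof -
  have "A \<inter> set_pmf p = B \<inter> set_pmf p"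
    using assms by auto
  then show ?thesis
    by (metis measure_Int_set_pmf)
qed

lemma mem_cylinder_self [simp]: "x \<in> cylinder A x"
  by (simp add: cylinder_def)

lemma cylinder_insert: "cylinder (insert e A) x = cylinder A x \<inter> cylinder {e} x"
  by (auto simp: cylinder_def)

text \<open>Let \<open>\<omega>\<close> have the values \<open>x e\<close> and \<open>y f\<close> at \<open>e\<close> and \<open>f\<close>; it exists because \<open>{e, f}\<close> is
  independent. Given the values of \<open>\<omega>\<close> on \<open>B = C - {e, f}\<close>, its values at \<open>e\<close> and at \<open>f\<close>
  determine each other, while each of them is independent of \<open>B\<close>.\<close>
lemma large_circuit_marginals_eq:
  assumes p: "pmf_representation E r p"
    and C: "matroid_circuit E r C" "e \<in> C" "f \<in> C" "e \<noteq> f" "C \<noteq> {e, f}"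
    and x: "x \<in> set_pmf p" and y: "y \<in> set_pmf p"
  shows "measure_pmf.prob p (cylinder {e} x) = measure_pmf.prob p (cylinder {f} y)"
proof -
  let ?B = "C - {e, f}"
  have proper: "matroid_indep E r D" if "D \<subset> C" for D
    using C(1) that by (simp add: matroid_circuit_def)
  have ind: "matroid_indep E r {f, e}" "matroid_indep E r (insert e ?B)" "matroid_indep E r (insert f ?B)"
  proof -
    have "{f, e} \<subset> C" "insert e ?B = C - {f}" "insert f ?B = C - {e}" "C - {e} \<subset> C" "C - {f} \<subset> C"
      using C(2-) by auto
    then show "matroid_indep E r {f, e}" "matroid_indep E r (insert e ?B)" "matroid_indep E r (insert f ?B)"
      using proper by simp_all
  qed
  have I: "measure_pmf.prob p (cylinder A x \<inter> cylinder {e} y) =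
           measure_pmf.prob p (cylinder A x) * measure_pmf.prob p (cylinder {e} y)"
    if "matroid_indep E r (insert e A)" "e \<notin> A" "x \<in> set_pmf p" "y \<in> set_pmf p" for A e x y
    using pmf_representation_indep[OF p that] .
  have D: "y c = x c"
    if "c \<in> C" "x \<in> set_pmf p" "y \<in> set_pmf p" "y \<in> cylinder (C - {c}) x" for c x y
    using pmf_representation_determined[OF p C(1) that] .
  have "measure_pmf.prob p (cylinder {e} x \<inter> cylinder {f} y) > 0"
  proof -
    have "measure_pmf.prob p (cylinder {e} x) > 0" "measure_pmf.prob p (cylinder {f} y) > 0"
      using x y by (auto intro: measure_pmf_posI)
    moreover have "f \<notin> {e}"
      using C by simp
    ultimately show ?thesis
      using I[OF ind(1) _ x y] by simp
  qed
  then obtain w where w: "w \<in> set_pmf p" "w e = x e" "w f = y f"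
    using measure_pmf_zero_iff[of p "cylinder {e} x \<inter> cylinder {f} y"] by (auto simp: cylinder_def)
  have "measure_pmf.prob p (cylinder ?B w \<inter> cylinder {e} w) = measure_pmf.prob p (cylinder ?B w \<inter> cylinder {f} w)"
  proof (rule measure_pmf_cong_support)
    fix z assume z: "z \<in> set_pmf p"
    show "z \<in> cylinder ?B w \<inter> cylinder {e} w \<longleftrightarrow> z \<in> cylinder ?B w \<inter> cylinder {f} w"
      using D[OF \<open>e \<in> C\<close> w(1) z] D[OF \<open>f \<in> C\<close> w(1) z] by (auto simp: cylinder_def)
  qed
  then have "measure_pmf.prob p (cylinder ?B w) * measure_pmf.prob p (cylinder {e} w)
    = measure_pmf.prob p (cylinder ?B w) * measure_pmf.prob p (cylinder {f} w)"
    using I[OF ind(2) _ w(1) w(1)] I[OF ind(3) _ w(1) w(1)] by auto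
  moreover have "measure_pmf.prob p (cylinder ?B w) > 0"
    using w by (auto intro!: measure_pmf_posI)
  moreover have "cylinder {e} w = cylinder {e} x" "cylinder {f} w = cylinder {f} y"
    using w by (auto simp: cylinder_def)
  ultimately show ?thesis
    by simp
qed

text \<open>More than \<open>1 / c\<close> support points would have total mass above one, so the
  support is finite; masses summing to one then give \<open>c\<close>.\<close>

lemma pmf_constant_uniform:
  fixes q :: "'a pmf"
  assumes c: "\<And>x. x \<in> set_pmf q \<Longrightarrow> pmf q x = c"
  shows "finite (set_pmf q)" "c = 1 / card (set_pmf q)"
proof -
  obtain x where x: "x \<in> set_pmf q"
    using set_pmf_not_empty by fast
  then have "c > 0"
    using c pmf_positive by metis
  show fin: "finite (set_pmf q)"
  proof (rule ccontr)
    assume "infinite (set_pmf q)"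
    obtain m :: nat where m: "real m * c > 1"
      using reals_Archimedean3[OF \<open>c > 0\<close>] by blast
    obtain F where F: "F \<subseteq> set_pmf q" "finite F" "card F = m"
      using infinite_arbitrarily_large[OF \<open>infinite (set_pmf q)\<close>] by blast
    have "measure_pmf.prob q F = sum (pmf q) F"
      using F by (simp add: measure_measure_pmf_finite)
    also have "\<dots> = (\<Sum>x\<in>F. c)"
      using F c by (intro sum.cong) auto
    finally show False
      using m F measure_pmf.prob_le_1[of q F] by simp
  qed
  have "(\<Sum>x\<in>set_pmf q. pmf q x) = 1"
    using fin by (simp add: sum_pmf_eq_1)
  then have "card (set_pmf q) * c = 1"
    using c by simp
  then show "c = 1 / card (set_pmf q)"
    by (metis mult_zero_left nonzero_eq_divide_eq mult.commute zero_neq_one)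
qed

text \<open>Uniformity spreads in four stages: over the values of one coordinate, between
  coordinates, to independent sets by the product rule, and to arbitrary sets through a
  basis.\<close>

lemma connected_pmf_representation_uniform:
  assumes M: "matroid E r" and conn: "matroid_connected E r" and r2: "r E \<ge> 2"
    and p: "pmf_representation E r p"
  obtains n where "pmf_uniform_model E r n p"
proof -
  let ?P = "\<lambda>e x. measure_pmf.prob p (cylinder {e} x)"
  have const: "?P e x = ?P e y" if "e \<in> E" "x \<in> set_pmf p" "y \<in> set_pmf p" for e x y
  proof -
    \<comment> \<open>A circuit with more than two elements compares the values of \<open>e\<close>
      at \<open>x\<close> and at \<open>y\<close> with one and the same value, that of
      \<open>f\<close> at \<open>x\<close>.\<close>
    obtain f C where C: "matroid_circuit E r C" "e \<in> C" "f \<in> C" "e \<noteq> f" "C \<noteq> {e, f}"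
      using connected_matroid_large_circuit[OF M conn r2 \<open>e \<in> E\<close>] .
    show ?thesis
      using large_circuit_marginals_eq[OF p C, of x x] large_circuit_marginals_eq[OF p C, of y x] that
      by simp
  qed
  have cross: "?P e x = ?P f x" if ef: "e \<in> E" "f \<in> E" "e \<noteq> f" and x: "x \<in> set_pmf p" for e f x
  proof -
    obtain C where C: "matroid_circuit E r C" "e \<in> C" "f \<in> C"
      using conn ef unfolding matroid_connected_def by metis
    show ?thesis
    proof (cases "C = {e, f}")
      \<comment> \<open>In a two-element circuit \<open>e\<close> and \<open>f\<close> determine
        each other, so both cylinders are the same event on the support.\<close>
      case True
      have D: "y c = x c"
        if "c \<in> C" "y \<in> set_pmf p" "y \<in> cylinder (C - {c}) x" for c y
        using pmf_representation_determined[OF p C(1) that(1) x that(2,3)] .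
      show ?thesis
      proof (rule measure_pmf_cong_support)
        fix z assume "z \<in> set_pmf p"
        then show "z \<in> cylinder {e} x \<longleftrightarrow> z \<in> cylinder {f} x"
          using D[of e z] D[of f z] C True by (auto simp: cylinder_def)
      qed
    next
      case False
      then show ?thesis
        by (intro large_circuit_marginals_eq[OF p C ef(3) False x x])
    qed
  qed
  have "E \<noteq> {}"
    using r2 matroid_rank_empty[OF M] by auto
  then obtain e0 where e0: "e0 \<in> E"
    by auto
  obtain x0 where x0: "x0 \<in> set_pmf p"
    using set_pmf_not_empty by fast
  define q where "q = map_pmf (\<lambda>x. x e0) p"
  define n where "n = card (set_pmf q)"
  have pmf_q: "pmf q (x e0) = ?P e0 x" for x
    unfolding q_def pmf_map by (rule arg_cong[where f = "measure_pmf.prob p"]) (auto simp: cylinder_def)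
  have "pmf q v = ?P e0 x0" if "v \<in> set_pmf q" for v
    using that pmf_q const[OF e0 _ x0] unfolding q_def by auto
  note q = pmf_constant_uniform[OF this]
  have P: "?P e x = 1 / real n" if "e \<in> E" "x \<in> set_pmf p" for e x
    using const[OF e0 that(2) x0] cross[OF that(1) e0 _ that(2)] q(2) n_def by (cases "e = e0") auto
  have "n \<ge> 2"
  proof -
    obtain x y where xy: "x \<in> set_pmf p" "y \<in> set_pmf p" "x e0 \<noteq> y e0"
      using p e0 unfolding pmf_representation_def by meson
    then have "{x e0, y e0} \<subseteq> set_pmf q"
      unfolding q_def by auto
    from card_mono[OF q(1) this] show ?thesis
      using xy by (simp add: n_def)
  qed
  have ind: "measure_pmf.prob p (cylinder I x) = 1 / real n ^ card I"
    if "finite I" "matroid_indep E r I" and x: "x \<in> set_pmf p" for I x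
    using that(1,2)
  proof (induction I rule: finite_induct)
    case empty
    then show ?case by (simp add: cylinder_def)
  next
    case (insert e I)
    have "measure_pmf.prob p (cylinder I x \<inter> cylinder {e} x) =
           measure_pmf.prob p (cylinder I x) * ?P e x"
      using pmf_representation_indep[OF p insert.prems insert.hyps(2) x x] .
    moreover have "matroid_indep E r I"
      using matroid_indep_mono[OF M insert.prems] by blast
    moreover have "?P e x = 1 / real n"
      using insert.prems x by (intro P) (auto simp: matroid_indep_def)
    ultimately show ?case
      using insert by (simp add: cylinder_insert[of e I])
  qed
  have "measure_pmf.prob p (cylinder A x) = 1 / real n ^ r A" if "A \<subseteq> E" "x \<in> set_pmf p" for A x
  proof -
    obtain I where I: "I \<subseteq> A" "matroid_indep E r I" "card I = r A"
      "\<And>a. a \<in> A - I \<Longrightarrow> \<exists>C. matroid_circuit E r C \<and> C \<subseteq> insert a I \<and> a \<in> C"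
      using matroid_basis_exists[OF M \<open>A \<subseteq> E\<close>] by metis
    have "measure_pmf.prob p (cylinder A x) = measure_pmf.prob p (cylinder I x)"
    proof (rule measure_pmf_cong_support)
      fix y assume y: "y \<in> set_pmf p"
      \<comment> \<open>For \<open>a\<close> outside the basis \<open>I\<close>, the fundamental
        circuit inside \<open>insert a I\<close> makes coordinate \<open>a\<close> depend on the
        coordinates in \<open>I\<close>. On the support, fixing \<open>I\<close> therefore fixes all
        of \<open>A\<close>.\<close>
      have "y a = x a" if "y \<in> cylinder I x" "a \<in> A" for a
      proof (cases "a \<in> I")
        case False
        then obtain C where C: "matroid_circuit E r C" "C \<subseteq> insert a I" "a \<in> C"
          using I(4) \<open>a \<in> A\<close> by auto
        have "y \<in> cylinder (C - {a}) x"
          using C that by (auto simp: cylinder_def)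
        then show ?thesis
          by (rule pmf_representation_determined[OF p C(1,3) \<open>x \<in> set_pmf p\<close> y])
      qed (use that in \<open>auto simp: cylinder_def\<close>)
      then show "y \<in> cylinder A x \<longleftrightarrow> y \<in> cylinder I x"
        using I(1) by (auto simp: cylinder_def)
    qed
    then show ?thesis
      using ind[OF _ I(2) that(2)] I matroid_finite_subset[OF M] that(1) by (metis finite_subset)
  qed
  with \<open>n \<ge> 2\<close> show thesis
    using that unfolding pmf_uniform_model_def by blast
qed

subsection \<open>Equality cases of entropy inequalities\<close>

text \<open>The entropy is written as the expectation of the surprisal of \<open>f\<close>. In this
  form the entropies of several maps are integrals over the same measure and can be compared
  pointwise.\<close>

definition pmf_entropy :: "'a pmf \<Rightarrow> ('a \<Rightarrow> 'b) \<Rightarrow> ennreal" where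
  "pmf_entropy p f = (\<integral>\<^sup>+x. ennreal (- log 2 (measure_pmf.prob p {y. f y = f x})) \<partial>p)"

lemma prob_fibre_pos: "x \<in> set_pmf p \<Longrightarrow> 0 < measure_pmf.prob p {y. f y = f x}"
  by (rule measure_pmf_posI) auto

lemma prob_fibre_eq_pmf_map: "measure_pmf.prob p {y. f y = f x} = pmf (map_pmf f p) (f x)"
  by (simp add: pmf_map vimage_def)

text \<open>Events of probability zero are covered, since the logarithm of zero is zero by
  convention.\<close>

lemma log_prob_nonpos: "log 2 (measure_pmf.prob p A) \<le> 0"
  using measure_pmf.prob_le_1[of p A]
  by (cases "measure_pmf.prob p A = 0") (simp add: log_def, simp add: zero_less_measure_iff)

text \<open>Finite entropy permits the passage from extended nonnegative integrals to Bochner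
  integrals, where differences can be formed.\<close>

lemma pmf_entropy_finite:
  fixes p :: "'a pmf"
  assumes "pmf_entropy p f \<noteq> \<infinity>"
  shows "integrable p (\<lambda>x. log 2 (measure_pmf.prob p {y. f y = f x}))" (is "integrable _ ?g")
    and "pmf_entropy p f = ennreal (- (\<integral>x. log 2 (measure_pmf.prob p {y. f y = f x}) \<partial>p))"
proof -
  have "integrable p (\<lambda>x. - ?g x)"
    using assms unfolding pmf_entropy_def
    by (intro integrableI_nonneg) (auto simp: log_prob_nonpos less_top)
  then show int: "integrable p ?g"
    by simp
  show "pmf_entropy p f = ennreal (- (\<integral>x. ?g x \<partial>p))"
    unfolding pmf_entropy_def
    by (subst nn_integral_eq_integral) (auto simp: int log_prob_nonpos)
qed

text \<open>With the sign known, equations between entropies can be stripped of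
  \<open>ennreal\<close>, which is injective only on nonnegative reals.\<close>

lemma integral_log_prob_nonpos:
  fixes p :: "'a pmf"
  shows "(\<integral>x. log 2 (measure_pmf.prob p {y. f y = f x}) \<partial>p) \<le> 0"
proof -
  have "0 \<le> (\<integral>x. - log 2 (measure_pmf.prob p {y. f y = f x}) \<partial>p)"
    by (intro integral_nonneg_AE) (auto simp: log_prob_nonpos)
  then show ?thesis
    by simp
qed

text \<open>The fibre of the pair is contained in the fibre of \<open>U\<close>, so the difference
  of the logarithms is nonnegative on the support; equal entropies give it mean zero, hence it
  vanishes there.\<close>

lemma pmf_entropy_pair_eq_imp_determined:
  assumes eq: "pmf_entropy p (\<lambda>x. (U x, V x)) = pmf_entropy p U" and fin: "pmf_entropy p U \<noteq> \<infinity>"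
    and x: "x \<in> set_pmf p" and y: "y \<in> set_pmf p" and U: "U y = U x"
  shows "V y = V x"
proof -
  define a where "a x = measure_pmf.prob p {y. U y = U x}" for x
  define d where "d x = measure_pmf.prob p {y. (U y, V y) = (U x, V x)}" for x
  have fin': "pmf_entropy p (\<lambda>x. (U x, V x)) \<noteq> \<infinity>"
    using eq fin by simp
  have int: "integrable p (\<lambda>x. log 2 (a x))" "integrable p (\<lambda>x. log 2 (d x))"
    using pmf_entropy_finite(1)[OF fin] pmf_entropy_finite(1)[OF fin'] by (auto simp: a_def d_def)
  have "(\<integral>x. log 2 (a x) \<partial>p) \<le> 0" "(\<integral>x. log 2 (d x) \<partial>p) \<le> 0"
    unfolding a_def d_def by (rule integral_log_prob_nonpos)+
  then have "(\<integral>x. log 2 (a x) \<partial>p) = (\<integral>x. log 2 (d x) \<partial>p)"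
    using eq pmf_entropy_finite(2)[OF fin] pmf_entropy_finite(2)[OF fin'] by (simp add: a_def d_def)
  then have "(\<integral>x. log 2 (a x) - log 2 (d x) \<partial>p) = 0"
    using int by simp
  moreover have pos: "0 < d z" if "z \<in> set_pmf p" for z
    using prob_fibre_pos[OF that] unfolding d_def by fast
  have le: "d z \<le> a z" for z
    unfolding a_def d_def by (intro measure_pmf.finite_measure_mono) auto
  have "AE z in p. 0 \<le> log 2 (a z) - log 2 (d z)"
    using pos le by (auto simp: AE_measure_pmf_iff intro!: log_mono)
  ultimately have "AE z in p. log 2 (a z) - log 2 (d z) = 0"
    using int by (subst integral_nonneg_eq_0_iff_AE[symmetric]) auto
  then have "log 2 (a x) = log 2 (d x)"
    using x by (auto simp: AE_measure_pmf_iff)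
  then have ad: "a x = d x"
    using pos[OF x] le[of x] by (simp add: log_inj[unfolded inj_on_def, rule_format, of 2])
  show ?thesis
  proof (rule ccontr)
    assume neq: "V y \<noteq> V x"
    \<comment> \<open>A support point \<open>y\<close> with another value of \<open>V\<close> lies
      in the fibre of \<open>U\<close> but not in that of the pair, adding positive mass to the
      larger fibre.\<close>
    have "d x + pmf p y = measure_pmf.prob p ({z. (U z, V z) = (U x, V x)} \<union> {y})"
      unfolding d_def using neq by (subst measure_pmf.finite_measure_Union) (auto simp: measure_pmf_single)
    also have "\<dots> \<le> a x"
      unfolding a_def using U by (intro measure_pmf.finite_measure_mono) auto
    finally show False
      using ad pmf_positive[OF y] by simp
  qed
qed

text \<open>Gibbs' inequality with its equality case: \<open>R - 1 - ln R\<close> is nonnegative for the likelihood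
  ratio \<open>R\<close> of the product of the marginals against the joint distribution. Additivity of the
  entropy says that \<open>ln R\<close> has mean \<open>0\<close>, and the mean of \<open>R\<close> is the product probability of the
  joint support. Hence \<open>R = 1\<close> and the joint support carries all of the product distribution.\<close>
lemma pmf_entropy_pair_additive_imp_indep:
  assumes eq: "pmf_entropy p (\<lambda>x. (U x, V x)) = pmf_entropy p U + pmf_entropy p V"
    and fin: "pmf_entropy p U \<noteq> \<infinity>" "pmf_entropy p V \<noteq> \<infinity>"
    and x: "x \<in> set_pmf p" and y: "y \<in> set_pmf p"
  shows "measure_pmf.prob p {z. U z = U x \<and> V z = V y} =
    measure_pmf.prob p {z. U z = U x} * measure_pmf.prob p {z. V z = V y}"
proof -
  define a where "a x = measure_pmf.prob p {y. U y = U x}" for x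
  define b where "b x = measure_pmf.prob p {y. V y = V x}" for x
  define d where "d x = measure_pmf.prob p {y. (U y, V y) = (U x, V x)}" for x
  define R where "R x = a x * b x / d x" for x
  define m where "m = map_pmf (\<lambda>x. (U x, V x)) p"
  define q where "q = pair_pmf (map_pmf U p) (map_pmf V p)"
  have pos: "0 < a z" "0 < b z" "0 < d z" "0 < R z" if "z \<in> set_pmf p" for z
    using prob_fibre_pos[OF that, of U] prob_fibre_pos[OF that, of V]
      prob_fibre_pos[OF that, of "\<lambda>x. (U x, V x)"]
    by (simp_all add: a_def b_def d_def R_def)
  have fin': "pmf_entropy p (\<lambda>x. (U x, V x)) \<noteq> \<infinity>"
    using eq fin by simp
  have int: "integrable p (\<lambda>x. log 2 (a x))" "integrable p (\<lambda>x. log 2 (b x))" "integrable p (\<lambda>x. log 2 (d x))"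
    using pmf_entropy_finite(1)[OF fin(1)] pmf_entropy_finite(1)[OF fin(2)] pmf_entropy_finite(1)[OF fin']
    by (auto simp: a_def b_def d_def)
  have "(\<integral>x. log 2 (a x) \<partial>p) \<le> 0" "(\<integral>x. log 2 (b x) \<partial>p) \<le> 0" "(\<integral>x. log 2 (d x) \<partial>p) \<le> 0"
    unfolding a_def b_def d_def by (rule integral_log_prob_nonpos)+
  then have "(\<integral>x. log 2 (d x) \<partial>p) = (\<integral>x. log 2 (a x) \<partial>p) + (\<integral>x. log 2 (b x) \<partial>p)"
    using eq pmf_entropy_finite(2)[OF fin(1)] pmf_entropy_finite(2)[OF fin(2)] pmf_entropy_finite(2)[OF fin']
    by (simp add: a_def b_def d_def flip: ennreal_plus)
  then have int0: "(\<integral>x. ln 2 * (log 2 (a x) + log 2 (b x) - log 2 (d x)) \<partial>p) = 0"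
    using int by simp
  have int_ln: "integrable p (\<lambda>x. ln 2 * (log 2 (a x) + log 2 (b x) - log 2 (d x)))"
    using int by simp
  have lnR: "ln (R z) = ln 2 * (log 2 (a z) + log 2 (b z) - log 2 (d z))" if "z \<in> set_pmf p" for z
    using pos[OF that] by (simp add: R_def log_def ln_div ln_mult field_simps)
  have "(\<integral>\<^sup>+z. ennreal (R z) \<partial>p) = (\<integral>\<^sup>+z. ennreal (pmf q z / pmf m z) \<partial>m)"
    unfolding m_def nn_integral_map_pmf
    by (intro nn_integral_cong) (simp add: R_def a_def b_def d_def prob_fibre_eq_pmf_map q_def pmf_pair
        prob_fibre_eq_pmf_map[where f = "\<lambda>x. (U x, V x)", simplified])
  also have "\<dots> = (\<integral>\<^sup>+z. ennreal (pmf m z) * ennreal (pmf q z / pmf m z) \<partial>count_space UNIV)"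
    by (rule nn_integral_measure_pmf)
  \<comment> \<open>The mass of \<open>m\<close> cancels only on its support, and off the support
    the integrand is zero; this is the source of the indicator.\<close>
  also have "\<dots> = (\<integral>\<^sup>+z. ennreal (pmf q z) * indicator (set_pmf m) z \<partial>count_space UNIV)"
    by (intro nn_integral_cong)
      (auto simp: indicator_def set_pmf_iff simp flip: ennreal_mult' ennreal_mult'')
  also have "\<dots> = emeasure q (set_pmf m)"
    by (subst nn_integral_measure_pmf[symmetric]) simp
  finally have nnR: "(\<integral>\<^sup>+z. ennreal (R z) \<partial>p) = ennreal (measure_pmf.prob q (set_pmf m))"
    by (simp add: measure_pmf.emeasure_eq_measure)
  have R_nonneg: "0 \<le> R z" for z
    by (simp add: R_def a_def b_def d_def)
  have intR: "integrable p R"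
    using nnR R_nonneg by (intro integrableI_nonneg) auto
  have ER: "(\<integral>z. R z \<partial>p) = measure_pmf.prob q (set_pmf m)"
    using nnR R_nonneg by (subst integral_eq_nn_integral) auto
  \<comment> \<open>On the support \<open>?g\<close> equals \<open>R - 1 - ln R\<close>; the
    expanded form inherits integrability from \<open>R\<close> and the three logarithms.\<close>
  let ?g = "\<lambda>z. R z - 1 - ln 2 * (log 2 (a z) + log 2 (b z) - log 2 (d z))"
  have g_nonneg: "AE z in p. 0 \<le> ?g z"
    unfolding AE_measure_pmf_iff using lnR pos ln_le_minus_one by fastforce
  have intg: "integrable p ?g"
    using intR int_ln by (intro Bochner_Integration.integrable_diff) auto
  have "(\<integral>z. ?g z \<partial>p) = (\<integral>z. R z - 1 \<partial>p) - (\<integral>x. ln 2 * (log 2 (a x) + log 2 (b x) - log 2 (d x)) \<partial>p)"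
    using intR int_ln by (intro Bochner_Integration.integral_diff) auto
  also have "\<dots> = measure_pmf.prob q (set_pmf m) - 1"
    unfolding int0 using intR by (simp add: ER)
  finally have Eg: "(\<integral>z. ?g z \<partial>p) = measure_pmf.prob q (set_pmf m) - 1" .
  moreover have "0 \<le> (\<integral>z. ?g z \<partial>p)"
    using g_nonneg by (rule integral_nonneg_AE)
  ultimately have q1: "measure_pmf.prob q (set_pmf m) = 1"
    using measure_pmf.prob_le_1[of q "set_pmf m"] by linarith
  then have "AE z in p. ?g z = 0"
    using Eg integral_nonneg_eq_0_iff_AE[OF intg g_nonneg] by simp
  then have R1: "R z = 1" if "z \<in> set_pmf p" for z
    using that pos[OF that] lnR[OF that] unfolding AE_measure_pmf_iff
    by (intro ln_eq_minus_one) auto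
  \<comment> \<open>The pair mixes two support points. It has positive product probability, so the
    full product mass of \<open>set_pmf m\<close> yields a support point \<open>w\<close> that
    attains both values.\<close>
  have "(U x, V y) \<in> set_pmf q"
    using x y by (simp add: q_def)
  moreover have "AE z in q. z \<in> set_pmf m"
    using q1 by (subst measure_pmf.AE_in_set_eq_1) auto
  ultimately have "(U x, V y) \<in> set_pmf m"
    by (auto simp: AE_measure_pmf_iff)
  then obtain w where w: "w \<in> set_pmf p" "U w = U x" "V w = V y"
    by (auto simp: m_def)
  have "d w = a w * b w"
    using R1[OF w(1)] pos[OF w(1)] by (simp add: R_def field_simps)
  then show ?thesis
    using w by (simp add: a_def b_def d_def)
qed

section \<open>Joint distributions and their entropy\<close>

lemma joint_rv_eq_iff: "joint_rv X A v = joint_rv X A w \<longleftrightarrow> (\<forall>e\<in>A. X e v = X e w)"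
  by (auto simp: joint_rv_def fun_eq_iff restrict_def)

text \<open>The joint variable takes values in a finite product of countable ranges, so its law is
  concentrated on a countable set and is a probability mass function.\<close>

lemma joint_pmf_exists:
  fixes X :: "'e \<Rightarrow> 'w \<Rightarrow> 'v"
  assumes P: "prob_space P" and E: "finite E" and X: "\<And>e. e \<in> E \<Longrightarrow> discrete_rv P (X e)"
  obtains p :: "('e \<Rightarrow> 'v) pmf" where
    "\<And>S. measure_pmf.prob p S = measure P {\<omega> \<in> space P. joint_rv X E \<omega> \<in> S}"
    "set_pmf p \<subseteq> joint_rv X E ` space P"
proof -
  interpret P: prob_space P
    by (fact P)
  let ?J = "joint_rv X E"
  have "countable (\<Pi>\<^sub>E e\<in>E. X e ` space P)"
    using E X by (intro countable_PiE) (auto simp: discrete_rv_def)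
  moreover have "?J ` space P \<subseteq> (\<Pi>\<^sub>E e\<in>E. X e ` space P)"
    by (auto simp: joint_rv_def)
  ultimately have cJ: "countable (?J ` space P)"
    by (rule countable_subset[rotated])
  have "?J -` {y} \<inter> space P \<in> sets P" if y: "y \<in> ?J ` space P" for y
  proof -
    have "?J -` {y} \<inter> space P = {\<omega> \<in> space P. \<forall>e\<in>E. X e \<omega> \<in> {y e}}"
      using y by (auto simp: joint_rv_eq_iff) (auto simp: joint_rv_def)
    also have "\<dots> \<in> sets P"
    proof (rule sets.sets_Collect_finite_All[OF _ E])
      fix e assume "e \<in> E"
      then have "X e \<in> measurable P (count_space UNIV)"
        using X by (simp add: discrete_rv_def)
      from measurable_sets[OF this, of "{y e}"]
      show "{\<omega> \<in> space P. X e \<omega> \<in> {y e}} \<in> sets P"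
        by (simp add: vimage_def Int_def conj_commute)
    qed
    finally show ?thesis .
  qed
  then have Jm: "?J \<in> measurable P (count_space (?J ` space P))"
    using cJ by (simp add: measurable_count_space_eq_countable)
  have J: "?J \<in> measurable P (count_space UNIV)"
    using measurable_compose[OF Jm, of "\<lambda>x. x" "count_space UNIV"] by simp
  let ?D = "distr P (count_space UNIV) ?J"
  interpret D: prob_space ?D
    using J by (rule P.prob_space_distr)
  have "AE x in ?D. x \<in> ?J ` space P"
    using J by (subst AE_distr_iff) auto
  then have "AE x in ?D. measure ?D {x} \<noteq> 0"
    using cJ by (subst D.AE_support_countable) auto
  then have rep: "measure_pmf (Abs_pmf ?D) = ?D"
    by (intro Abs_pmf_inverse) (simp add: D.prob_space_axioms)
  show thesis
  proof (rule that)
    show prob: "measure_pmf.prob (Abs_pmf ?D) S = measure P {\<omega> \<in> space P. ?J \<omega> \<in> S}" for S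
      unfolding rep by (subst measure_distr[OF J]) (auto simp: vimage_def Int_def conj_commute)
    show "set_pmf (Abs_pmf ?D) \<subseteq> ?J ` space P"
    proof
      fix x assume "x \<in> set_pmf (Abs_pmf ?D)"
      then have "measure P {\<omega> \<in> space P. ?J \<omega> \<in> {x}} \<noteq> 0"
        unfolding prob[symmetric] measure_pmf_single by (simp add: set_pmf_iff)
      then have "{\<omega> \<in> space P. ?J \<omega> \<in> {x}} \<noteq> {}"
        by (metis measure_empty)
      then show "x \<in> ?J ` space P"
        by auto
    qed
  qed
qed

lemma restrict_eq_restrict_iff: "restrict x A = restrict y A \<longleftrightarrow> (\<forall>e\<in>A. x e = y e)"
  by (metis restrict_apply' restrict_ext)

text \<open>The law of \<open>joint_rv X A\<close> is the image of \<open>p\<close> under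
  restriction to \<open>A\<close>. Values of probability zero, inside or outside the range,
  contribute zero to the sum.\<close>

lemma shannon_entropy_joint_rv:
  fixes X :: "'e \<Rightarrow> 'w \<Rightarrow> 'v"
  assumes p: "\<And>S. measure_pmf.prob p S = measure P {\<omega> \<in> space P. joint_rv X E \<omega> \<in> S}"
    and sub: "set_pmf p \<subseteq> joint_rv X E ` space P" and AE: "A \<subseteq> E"
  shows "shannon_entropy P (joint_rv X A) = pmf_entropy p (\<lambda>x. restrict x A)"
proof -
  define q where "q = map_pmf (\<lambda>x. restrict x A) p"
  have J: "joint_rv X A \<omega> = restrict (joint_rv X E \<omega>) A" for \<omega>
    using AE by (auto simp: joint_rv_def fun_eq_iff restrict_def)
  have pq: "measure P {\<omega> \<in> space P. joint_rv X A \<omega> = y} = pmf q y" for y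
    unfolding q_def pmf_map p by (simp add: J)
  have zero: "pmf q y = 0" if "y \<notin> joint_rv X A ` space P" for y
  proof -
    have "set_pmf q \<subseteq> joint_rv X A ` space P"
      unfolding q_def using sub by (auto simp: J)
    then show ?thesis
      using that by (auto simp: set_pmf_iff)
  qed
  have "pmf_entropy p (\<lambda>x. restrict x A) = (\<integral>\<^sup>+x. ennreal (- log 2 (pmf q (restrict x A))) \<partial>p)"
    unfolding pmf_entropy_def q_def
    by (simp add: prob_fibre_eq_pmf_map[where f = "\<lambda>x. restrict x A"])
  also have "\<dots> = (\<integral>\<^sup>+y. ennreal (- log 2 (pmf q y)) \<partial>q)"
    unfolding q_def by simp
  also have "\<dots> = (\<integral>\<^sup>+y. ennreal (pmf q y) * ennreal (- log 2 (pmf q y)) \<partial>count_space UNIV)"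
    by (rule nn_integral_measure_pmf)
  also have "\<dots> = (\<integral>\<^sup>+y. ennreal (- (pmf q y * log 2 (pmf q y))) \<partial>count_space UNIV)"
    by (simp flip: ennreal_mult')
  also have "\<dots> = (\<integral>\<^sup>+y. ennreal (- (pmf q y * log 2 (pmf q y))) \<partial>count_space (joint_rv X A ` space P))"
    using zero by (intro nn_integral_count_space_eq) auto
  finally show ?thesis
    unfolding shannon_entropy_def pq ..
qed

text \<open>Only the partition into fibres matters. This lets a pair of restrictions to
  \<open>A\<close> and \<open>B\<close> be replaced by the restriction to their union.\<close>

lemma pmf_entropy_cong:
  assumes "\<And>x y. f x = f y \<longleftrightarrow> g x = g y"
  shows "pmf_entropy p f = pmf_entropy p g"
  unfolding pmf_entropy_def assms ..

text \<open>Rank identities become entropy identities after division by \<open>l\<close>: additivity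
  on independent sets gives independence, \<open>r C = r (C - {c})\<close> gives dependence, and
  \<open>r {e} = 1\<close> excludes constant variables.\<close>

lemma entropic_imp_pmf_representation:
  fixes E :: "'e set"
  assumes ent: "entropic TYPE('w) TYPE('v) E r" and M: "matroid E r"
    and nl: "\<And>e. e \<in> E \<Longrightarrow> matroid_indep E r {e}"
  obtains p :: "('e \<Rightarrow> 'v) pmf" where "pmf_representation E r p" "set_pmf p \<subseteq> extensional E"
proof -
  obtain P :: "'w measure" and X :: "'e \<Rightarrow> 'w \<Rightarrow> 'v" and l :: real where
    P: "prob_space P" and X: "\<forall>e\<in>E. discrete_rv P (X e)" and l: "l > 0"
    and ent: "\<forall>A\<subseteq>E. of_nat (r A) = ennreal l * shannon_entropy P (joint_rv X A)"
    using ent unfolding entropic_def by auto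
  have "finite E"
    using matroid_finite_subset[OF M] by simp
  then obtain p where p: "\<And>S. measure_pmf.prob p S = measure P {\<omega> \<in> space P. joint_rv X E \<omega> \<in> S}"
    and sub: "set_pmf p \<subseteq> joint_rv X E ` space P"
    using joint_pmf_exists[OF P, of E X] X by auto
  define H where "H A = pmf_entropy p (\<lambda>x. restrict x A)" for A
  have H: "H A = ennreal (r A / l)" if "A \<subseteq> E" for A
  proof -
    have "H A = ennreal (1 / l * l) * H A"
      using l by simp
    also have "\<dots> = ennreal (1 / l) * (ennreal l * H A)"
      using l by (subst ennreal_mult) (auto simp: mult.assoc)
    also have "ennreal l * H A = of_nat (r A)"
      using ent that shannon_entropy_joint_rv[OF p sub that] by (simp add: H_def)
    finally show ?thesis
      using l by (simp add: ennreal_of_nat_eq_real_of_nat flip: ennreal_mult)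
  qed
  \<comment> \<open>Ranks are finite, so every entropy here is finite, as the equality cases
    require.\<close>
  have fin: "H A \<noteq> \<infinity>" if "A \<subseteq> E" for A
    using H[OF that] by simp
  have H_pair: "pmf_entropy p (\<lambda>x. (restrict x A, restrict x B)) = H (A \<union> B)" for A B
    unfolding H_def by (rule pmf_entropy_cong) (auto simp: restrict_eq_restrict_iff)
  have "pmf_representation E r p"
  proof (rule pmf_representationI)
    show "measure_pmf.prob p (cylinder A x \<inter> cylinder {e} y) =
        measure_pmf.prob p (cylinder A x) * measure_pmf.prob p (cylinder {e} y)"
      if ind: "matroid_indep E r (insert e A)" and e: "e \<notin> A" and xy: "x \<in> set_pmf p" "y \<in> set_pmf p" for A e x y
    proof -
      have E: "insert e A \<subseteq> E" "A \<subseteq> E" "{e} \<subseteq> E"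
        using ind by (auto simp: matroid_indep_def)
      have "matroid_indep E r A" "matroid_indep E r {e}"
        using matroid_indep_mono[OF M ind] by auto
      moreover have "finite A"
        using matroid_finite_subset[OF M E(2)] .
      ultimately have "r (insert e A) = r A + r {e}"
        using ind e by (simp add: matroid_indep_def)
      then have "H (A \<union> {e}) = H A + H {e}"
        using H E l by (simp add: add_divide_distrib)
      then have "measure_pmf.prob p {z. restrict z A = restrict x A \<and> restrict z {e} = restrict y {e}} =
        measure_pmf.prob p {z. restrict z A = restrict x A} * measure_pmf.prob p {z. restrict z {e} = restrict y {e}}"
        using fin[OF E(2)] fin[OF E(3)] xy
        by (intro pmf_entropy_pair_additive_imp_indep) (simp_all only: H_pair H_def[symmetric] not_False_eq_True)
      moreover have "{z. restrict z A = restrict x A \<and> restrict z {e} = restrict y {e}} = cylinder A x \<inter> cylinder {e} y"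
        "{z. restrict z A = restrict x A} = cylinder A x" "{z. restrict z {e} = restrict y {e}} = cylinder {e} y"
        by (auto simp: cylinder_def restrict_eq_restrict_iff)
      ultimately show ?thesis
        by simp
    qed
    show "y c = x c"
      if C: "matroid_circuit E r C" "c \<in> C" and xy: "x \<in> set_pmf p" "y \<in> set_pmf p" "y \<in> cylinder (C - {c}) x" for C c x y
    proof -
      have E: "C \<subseteq> E" "C - {c} \<subseteq> E"
        using C by (auto simp: matroid_circuit_def)
      have "H ((C - {c}) \<union> {c}) = H (C - {c})"
        using H E matroid_circuit_rank[OF M C] C(2) by (simp add: insert_absorb)
      then have "pmf_entropy p (\<lambda>x. (restrict x (C - {c}), restrict x {c})) = pmf_entropy p (\<lambda>x. restrict x (C - {c}))"
        by (simp only: H_pair H_def[symmetric])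
      then have "restrict y {c} = restrict x {c}"
        using fin[OF E(2)] xy(1,2) unfolding H_def
        by (rule pmf_entropy_pair_eq_imp_determined) (use xy in \<open>auto simp: cylinder_def restrict_eq_restrict_iff\<close>)
      then show ?thesis
        by (simp add: restrict_eq_restrict_iff)
    qed
    show "\<exists>x\<in>set_pmf p. \<exists>y\<in>set_pmf p. x e \<noteq> y e" if e: "e \<in> E" for e
    proof (rule ccontr)
      assume "\<not> ?thesis"
      then have const: "y e = x e" if "x \<in> set_pmf p" "y \<in> set_pmf p" for x y
        using that by auto
      have "measure_pmf.prob p {y. restrict y {e} = restrict x {e}} = 1" if "x \<in> set_pmf p" for x
        using const[OF that] by (subst measure_pmf.prob_eq_1) (auto simp: AE_measure_pmf_iff restrict_eq_restrict_iff)
      then have "H {e} = (\<integral>\<^sup>+x. 0 \<partial>p)"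
        unfolding H_def pmf_entropy_def by (intro nn_integral_cong_AE) (auto simp: AE_measure_pmf_iff)
      moreover have "H {e} = ennreal (1 / l)"
        using H[of "{e}"] nl[OF e] e by (simp add: matroid_indep_def)
      ultimately show False
        using l by simp
    qed
  qed
  moreover have "set_pmf p \<subseteq> extensional E"
    using sub by (auto simp: joint_rv_def)
  ultimately show thesis
    using that by simp
qed

subsection \<open>Representations with values in arbitrary measurable spaces\<close>

lemma atom_of_eq_iff:
  assumes "x \<in> space N" "y \<in> space N"
  shows "atom_of N x = atom_of N y \<longleftrightarrow> (\<forall>S\<in>sets N. x \<in> S \<longleftrightarrow> y \<in> S)"
proof
  assume "atom_of N x = atom_of N y"
  then have "x \<in> atom_of N y"
    using assms(1) by (auto simp: atom_of_def)
  then show "\<forall>S\<in>sets N. x \<in> S \<longleftrightarrow> y \<in> S"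
    by (auto simp: atom_of_def)
next
  assume "\<forall>S\<in>sets N. x \<in> S \<longleftrightarrow> y \<in> S"
  then show "atom_of N x = atom_of N y"
    by (simp add: atom_of_def)
qed

text \<open>The sets that do not separate \<open>x\<close> and \<open>y\<close> form a
  \<sigma>-algebra containing the one-coordinate generators. Thus a measurable function on the
  product cannot see below the atoms of the factors.\<close>

lemma PiM_sets_not_separating:
  assumes A: "A \<in> sets (PiM I N)"
    and x: "x \<in> space (PiM I N)" and y: "y \<in> space (PiM I N)"
    and xy: "\<And>i S. i \<in> I \<Longrightarrow> S \<in> sets (N i) \<Longrightarrow> x i \<in> S \<longleftrightarrow> y i \<in> S"
  shows "x \<in> A \<longleftrightarrow> y \<in> A"
proof -
  have xy': "x \<in> (\<Pi>\<^sub>E i\<in>I. space (N i))" "y \<in> (\<Pi>\<^sub>E i\<in>I. space (N i))"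
    using x y by (simp_all add: space_PiM)
  show ?thesis
    using A unfolding sets_PiM_single
  proof (induction rule: sigma_sets.induct)
    case (Basic A)
    then show ?case
      using xy xy' by auto
  qed (use xy' in auto)
qed

text \<open>On a countable sample space the classes of points with the same atom are preimages of
  measurable sets, although the atoms themselves need not be measurable.\<close>
lemma atom_class_measurable:
  assumes X: "X \<in> measurable P N" and cP: "countable (space P)" and w: "w \<in> space P"
  obtains S where "S \<in> sets N" "X -` S \<inter> space P = {v \<in> space P. atom_of N (X v) = atom_of N (X w)}"
proof -
  have XN: "X v \<in> space N" if "v \<in> space P" for v
    using measurable_space[OF X that] .
  define B where "B = {v \<in> space P. atom_of N (X v) \<noteq> atom_of N (X w)}"
  \<comment> \<open>Some measurable set separates the two values; it or its complement contains
    \<open>X v\<close> and avoids \<open>X w\<close>.\<close>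
  have "\<exists>T\<in>sets N. X w \<notin> T \<and> X v \<in> T" if v: "v \<in> B" for v
  proof -
    have "X v \<in> space N" "X w \<in> space N"
      using XN w v by (auto simp: B_def)
    moreover from this obtain S where S: "S \<in> sets N" "X v \<in> S \<longleftrightarrow> X w \<notin> S"
      using v by (auto simp: B_def atom_of_eq_iff)
    moreover have "space N - S \<in> sets N"
      using S by auto
    ultimately show ?thesis
      by (cases "X v \<in> S") (auto intro: bexI[of _ S] bexI[of _ "space N - S"])
  qed
  then obtain T where T: "\<And>v. v \<in> B \<Longrightarrow> T v \<in> sets N \<and> X w \<notin> T v \<and> X v \<in> T v"
    by metis
  have "countable B"
    using cP by (auto simp: B_def intro: countable_subset)
  then have S: "space N - (\<Union>v\<in>B. T v) \<in> sets N"
    using T by (intro sets.compl_sets sets.countable_UN') auto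
  moreover have "X -` (space N - (\<Union>v\<in>B. T v)) \<inter> space P = {v \<in> space P. atom_of N (X v) = atom_of N (X w)}"
  proof (intro equalityI subsetI)
    fix v assume "v \<in> X -` (space N - (\<Union>v\<in>B. T v)) \<inter> space P"
    then have "v \<in> space P" "v \<notin> B"
      using T by auto
    then show "v \<in> {v \<in> space P. atom_of N (X v) = atom_of N (X w)}"
      by (auto simp: B_def)
  next
    fix v assume "v \<in> {v \<in> space P. atom_of N (X v) = atom_of N (X w)}"
    then have v: "v \<in> space P" "\<forall>S\<in>sets N. X v \<in> S \<longleftrightarrow> X w \<in> S"
      using XN w by (auto simp: atom_of_eq_iff)
    moreover have "X w \<in> space N - (\<Union>v\<in>B. T v)"
      using XN w T by auto
    ultimately show "v \<in> X -` (space N - (\<Union>v\<in>B. T v)) \<inter> space P"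
      using S by auto
  qed
  ultimately show thesis
    using that by blast
qed

text \<open>The \<sigma>-algebras see only atoms, so equality of values is read as equality of
  atoms. Positive mass of all singletons makes the support the whole image of the sample
  space.\<close>

lemma representation_imp_pmf_representation:
  fixes E :: "'e set" and P :: "'w measure" and N :: "'e \<Rightarrow> 'v measure"
  assumes R: "prob_space_representation E r P N X" and nz: "nonzero_singletons P" and M: "matroid E r"
    and nl: "\<And>e. e \<in> E \<Longrightarrow> \<not> matroid_loop E r e"
  obtains p :: "('e \<Rightarrow> 'v set) pmf" where "pmf_representation E r p"
    "set_pmf p = joint_rv (\<lambda>e \<omega>. atom_of (N e) (X e \<omega>)) E ` space P"
    "\<forall>S. measure_pmf.prob p S = measure P {\<omega> \<in> space P. joint_rv (\<lambda>e \<omega>. atom_of (N e) (X e \<omega>)) E \<omega> \<in> S}"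
proof -
  define Y where "Y = (\<lambda>e \<omega>. atom_of (N e) (X e \<omega>))"
  let ?J = "joint_rv Y E"
  have P: "prob_space P" and cP: "countable (space P)" and sP: "sets P = Pow (space P)"
    using R by (auto simp: prob_space_representation_def discrete_prob_space_def)
  interpret P: prob_space P
    by (fact P)
  have X: "X e \<in> measurable P (N e)" if "e \<in> E" for e
    using R that by (simp add: prob_space_representation_def)
  have XN: "X e w \<in> space (N e)" if "e \<in> E" "w \<in> space P" for e w
    using measurable_space[OF X[OF that(1)] that(2)] .
  have finE: "finite E"
    using matroid_finite_subset[OF M] by simp
  have "discrete_rv P (Y e)" for e
    using cP by (auto simp: discrete_rv_def measurable_def sP)
  then obtain p where p: "\<And>S. measure_pmf.prob p S = measure P {\<omega> \<in> space P. ?J \<omega> \<in> S}"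
    and sub: "set_pmf p \<subseteq> ?J ` space P"
    using joint_pmf_exists[OF P finE, of Y] by auto
  have "?J w \<in> set_pmf p" if w: "w \<in> space P" for w
  proof -
    have "0 < measure P {w}"
      using nz w by (simp add: nonzero_singletons_def zero_less_measure_iff)
    also have "\<dots> \<le> measure P {\<omega> \<in> space P. ?J \<omega> \<in> {?J w}}"
      using w by (intro P.finite_measure_mono) (auto simp: sP)
    finally show ?thesis
      using p[of "{?J w}"] by (simp add: measure_pmf_single set_pmf_iff)
  qed
  with sub have supp: "set_pmf p = ?J ` space P"
    by auto
  have J: "?J w e = Y e w" if "e \<in> E" for w e
    using that by (simp add: joint_rv_def)
  have Y_eq: "Y e v = Y e w \<longleftrightarrow> (\<forall>S\<in>sets (N e). X e v \<in> S \<longleftrightarrow> X e w \<in> S)"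
    if "e \<in> E" "v \<in> space P" "w \<in> space P" for e v w
    unfolding Y_def using that XN by (intro atom_of_eq_iff) auto
  \<comment> \<open>Each \<open>b\<close> has its own sample point \<open>s b\<close>, so the
    prescribed values need not be known to occur together.\<close>
  have prod: "measure P {\<omega> \<in> space P. \<forall>b\<in>B. Y b \<omega> = Y b (s b)} = (\<Prod>b\<in>B. measure P {\<omega> \<in> space P. Y b \<omega> = Y b (s b)})"
    if B: "matroid_indep E r B" and s: "\<And>b. b \<in> B \<Longrightarrow> s b \<in> space P" for B s
  proof (cases "B = {}")
    case True
    then show ?thesis
      by (simp add: P.prob_space)
  next
    case False
    have BE: "B \<subseteq> E"
      using B by (simp add: matroid_indep_def)
    have finB: "finite B"
      using matroid_finite_subset[OF M BE] .
    have "\<exists>S. S \<in> sets (N b) \<and> X b -` S \<inter> space P = {\<omega> \<in> space P. Y b \<omega> = Y b (s b)}" if "b \<in> B" for b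
      using atom_class_measurable[OF X cP s[OF that]] that BE unfolding Y_def by (metis subsetD)
    then obtain S where S: "\<And>b. b \<in> B \<Longrightarrow> S b \<in> sets (N b)"
      "\<And>b. b \<in> B \<Longrightarrow> X b -` S b \<inter> space P = {\<omega> \<in> space P. Y b \<omega> = Y b (s b)}"
      by metis
    have "P.indep_vars N X B"
      using R B by (simp add: prob_space_representation_def)
    then have "measure P (\<Inter>b\<in>B. X b -` S b \<inter> space P) = (\<Prod>b\<in>B. measure P (X b -` S b \<inter> space P))"
      using False finB S(1) by (intro P.indep_varsD[where I = B]) auto
    moreover have "(\<Inter>b\<in>B. X b -` S b \<inter> space P) = {\<omega> \<in> space P. \<forall>b\<in>B. Y b \<omega> = Y b (s b)}"
      using False S(2) by auto
    ultimately show ?thesis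
      using S(2) by simp
  qed
  have cyl: "measure_pmf.prob p (cylinder A (?J v)) = measure P {\<omega> \<in> space P. \<forall>b\<in>A. Y b \<omega> = Y b v}"
    if "A \<subseteq> E" for A v
    unfolding p using that by (simp add: cylinder_def J subset_iff cong: ball_cong)
  have "pmf_representation E r p"
  proof (rule pmf_representationI)
    show "measure_pmf.prob p (cylinder A x \<inter> cylinder {e} y) =
        measure_pmf.prob p (cylinder A x) * measure_pmf.prob p (cylinder {e} y)"
      if ind: "matroid_indep E r (insert e A)" and e: "e \<notin> A" and xy: "x \<in> set_pmf p" "y \<in> set_pmf p" for A e x y
    proof -
      obtain v w where vw: "v \<in> space P" "w \<in> space P" "x = ?J v" "y = ?J w"
        using xy supp by auto
      define s where "s b = (if b = e then w else v)" for b
      have E: "insert e A \<subseteq> E" "A \<subseteq> E" "{e} \<subseteq> E"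
        using ind by (auto simp: matroid_indep_def)
      have finA: "finite A"
        using matroid_finite_subset[OF M E(2)] .
      have indA: "matroid_indep E r A"
        using matroid_indep_mono[OF M ind] by auto
      have "measure_pmf.prob p (cylinder A x \<inter> cylinder {e} y) =
        measure P {\<omega> \<in> space P. \<forall>b\<in>insert e A. Y b \<omega> = Y b (s b)}"
        unfolding p using E J e vw
        by (intro arg_cong[where f = "measure P"] Collect_cong)
          (auto simp: cylinder_def s_def subset_iff)
      also have "\<dots> = (\<Prod>b\<in>insert e A. measure P {\<omega> \<in> space P. Y b \<omega> = Y b (s b)})"
        using vw by (intro prod[OF ind]) (auto simp: s_def)
      also have "\<dots> = measure P {\<omega> \<in> space P. Y e \<omega> = Y e w} * (\<Prod>b\<in>A. measure P {\<omega> \<in> space P. Y b \<omega> = Y b (s b)})"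
        using finA e by (simp add: s_def)
      also have "(\<Prod>b\<in>A. measure P {\<omega> \<in> space P. Y b \<omega> = Y b (s b)}) = (\<Prod>b\<in>A. measure P {\<omega> \<in> space P. Y b \<omega> = Y b v})"
        using e by (intro prod.cong) (auto simp: s_def)
      also have "\<dots> = measure_pmf.prob p (cylinder A x)"
        unfolding vw cyl[OF E(2)] using prod[OF indA, of "\<lambda>_. v"] vw by simp
      also have "measure P {\<omega> \<in> space P. Y e \<omega> = Y e w} = measure_pmf.prob p (cylinder {e} y)"
        unfolding vw cyl[OF E(3)] by simp
      finally show ?thesis
        by simp
    qed
    show "y c = x c"
      if C: "matroid_circuit E r C" "c \<in> C" and xy: "x \<in> set_pmf p" "y \<in> set_pmf p" "y \<in> cylinder (C - {c}) x" for C c x y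
    proof -
      obtain v w where vw: "v \<in> space P" "w \<in> space P" "x = ?J v" "y = ?J w"
        using xy supp by auto
      have CE: "C \<subseteq> E" and cE: "c \<in> E"
        using C by (auto simp: matroid_circuit_def)
      obtain f where f: "f \<in> measurable (PiM (C - {c}) N) (N c)"
        "\<forall>\<omega>\<in>space P. f (joint_rv X (C - {c}) \<omega>) = X c \<omega>"
        using R C unfolding prob_space_representation_def by metis
      have spc: "joint_rv X (C - {c}) u \<in> space (PiM (C - {c}) N)" if "u \<in> space P" for u
        using XN that CE by (auto simp: space_PiM joint_rv_def)
      \<comment> \<open>The points \<open>v\<close> and \<open>w\<close> agree up to atoms on
        \<open>C - {c}\<close>, so the preimage of \<open>S\<close> under \<open>f\<close> contains
        both of their joint values or neither.\<close>
      have "X c w \<in> S \<longleftrightarrow> X c v \<in> S" if S: "S \<in> sets (N c)" for S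
      proof -
        let ?A = "f -` S \<inter> space (PiM (C - {c}) N)"
        have "joint_rv X (C - {c}) w \<in> ?A \<longleftrightarrow> joint_rv X (C - {c}) v \<in> ?A"
        proof (rule PiM_sets_not_separating[OF _ spc[OF vw(2)] spc[OF vw(1)]])
          show "?A \<in> sets (PiM (C - {c}) N)"
            using measurable_sets[OF f(1) S] .
          fix i T assume i: "i \<in> C - {c}" and T: "T \<in> sets (N i)"
          have "Y i w = Y i v"
          proof -
            have "y i = x i"
              using xy(3) i by (simp add: cylinder_def)
            moreover have "i \<in> E"
              using i CE by auto
            ultimately show ?thesis
              using vw J by simp
          qed
          then show "joint_rv X (C - {c}) w i \<in> T \<longleftrightarrow> joint_rv X (C - {c}) v i \<in> T"
            using i T CE vw Y_eq[of i w v] by (auto simp: joint_rv_def)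
        qed
        then show ?thesis
          using f(2) spc vw by simp
      qed
      then have "Y c w = Y c v"
        using Y_eq[OF cE vw(2,1)] by simp
      then show ?thesis
        using J[OF cE] vw by simp
    qed
    show "\<exists>x\<in>set_pmf p. \<exists>y\<in>set_pmf p. x e \<noteq> y e" if e: "e \<in> E" for e
    proof -
      \<comment> \<open>Disjoint sets of positive probability are both hit, and \<open>S\<close>
        separates the two values, so two different atoms occur.\<close>
      obtain S T where ST: "S \<in> sets (N e)" "S \<inter> T = {}"
        "measure P (X e -` S \<inter> space P) \<noteq> 0" "measure P (X e -` T \<inter> space P) \<noteq> 0"
        using R e nl[OF e] unfolding prob_space_representation_def by metis
      then have "X e -` S \<inter> space P \<noteq> {}" "X e -` T \<inter> space P \<noteq> {}"
        by (metis measure_empty)+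
      then obtain v w where vw: "v \<in> space P" "w \<in> space P" "X e v \<in> S" "X e w \<in> T"
        by auto
      then have "X e w \<notin> S"
        using ST(2) by auto
      then have "Y e v \<noteq> Y e w"
        using Y_eq[OF e vw(1,2)] vw ST(1) by auto
      then have "?J v e \<noteq> ?J w e"
        using J[OF e] by simp
      then show ?thesis
        unfolding supp using vw by blast
    qed
  qed
  then show thesis
    using that[of p] p supp unfolding Y_def by simp
qed

text \<open>The atoms at \<open>e\<close> are distributed as one coordinate of a uniform model,
  where every value has probability \<open>1 / n\<close> because \<open>r {e} = 1\<close>.\<close>

lemma representation_uniformly_distributed:
  fixes P :: "'w measure"
  assumes R: "prob_space_representation E r P N X" and nz: "nonzero_singletons P" and M: "matroid E r"
    and conn: "matroid_connected E r" and r2: "r E \<ge> 2" and e: "e \<in> E"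
  shows "uniformly_distributed P (N e) (X e)"
proof -
  let ?Y = "\<lambda>e \<omega>. atom_of (N e) (X e \<omega>)"
  let ?J = "joint_rv ?Y E"
  have ind: "matroid_indep E r {e}" if "e \<in> E" for e
    using connected_matroid_singleton_indep[OF M conn r2 that] .
  then have "\<not> matroid_loop E r e" if "e \<in> E" for e
    using that by (auto simp: matroid_loop_def matroid_circuit_def)
  then obtain p where p: "pmf_representation E r p" and supp: "set_pmf p = ?J ` space P"
    and prob: "\<forall>S. measure_pmf.prob p S = measure P {\<omega> \<in> space P. ?J \<omega> \<in> S}"
    by (rule representation_imp_pmf_representation[OF R nz M]) auto
  obtain n where n: "pmf_uniform_model E r n p"
    using connected_pmf_representation_uniform[OF M conn r2 p] .
  have J: "?J w e = ?Y e w" for w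
    using e by (simp add: joint_rv_def)
  define q where "q = map_pmf (\<lambda>x. x e) p"
  have set_q: "set_pmf q = ?Y e ` space P"
    unfolding q_def by (simp add: supp image_image J)
  have pmf_q: "pmf q a = measure P {\<omega> \<in> space P. ?Y e \<omega> = a}" for a
    unfolding q_def pmf_map prob[rule_format] by (simp add: J)
  have const: "pmf q a = 1 / n" if a: "a \<in> set_pmf q" for a
  proof -
    obtain x where x: "x \<in> set_pmf p" "a = x e"
      using a by (auto simp: q_def)
    have "pmf q a = measure_pmf.prob p (cylinder {e} x)"
      unfolding q_def pmf_map by (rule arg_cong[where f = "measure_pmf.prob p"]) (auto simp: cylinder_def x)
    also have "\<dots> = 1 / real n ^ r {e}"
      using n x e by (simp add: pmf_uniform_model_def)
    finally show ?thesis
      using ind[OF e] by (simp add: matroid_indep_def)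
  qed
  note unif = pmf_constant_uniform[OF const]
  have XN: "X e w \<in> space (N e)" if "w \<in> space P" for w
    using R e that unfolding prob_space_representation_def by (metis measurable_space)
  \<comment> \<open>For values of \<open>X e\<close>, lying in an atom is the same as having that
    atom. This matches the event in \<open>uniformly_distributed\<close> with a fibre of
    \<open>?Y e\<close>.\<close>
  have mem: "X e v \<in> ?Y e w \<longleftrightarrow> ?Y e v = ?Y e w" if "v \<in> space P" "w \<in> space P" for v w
    unfolding atom_of_eq_iff[OF XN[OF that(1)] XN[OF that(2)]]
    using XN[OF that(1)] by (auto simp: atom_of_def)
  have "measure P {\<omega> \<in> space P. X e \<omega> \<in> a} = 1 / card (?Y e ` space P)" if a: "a \<in> ?Y e ` space P" for a
  proof -
    have "{\<omega> \<in> space P. X e \<omega> \<in> a} = {\<omega> \<in> space P. ?Y e \<omega> = a}"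
      using a mem by auto
    then show ?thesis
      using const[of a] a unif(2) by (simp add: set_q pmf_q)
  qed
  moreover have "finite (?Y e ` space P)" "?Y e ` space P \<noteq> {}"
    using unif(1) set_pmf_not_empty[of q] by (simp_all add: set_q)
  ultimately show ?thesis
    unfolding uniformly_distributed_def Let_def by simp
qed

subsection \<open>Uniform codes\<close>

text \<open>The product form avoids division: nonempty fibres of \<open>joint_rv Z A\<close> all
  have \<open>card W / n ^ r A\<close> points. Words are indexed by an abstract set
  \<open>W\<close>, so that points and values can later be taken from any infinite types.\<close>

definition uniform_code :: "'e set \<Rightarrow> ('e set \<Rightarrow> nat) \<Rightarrow> nat \<Rightarrow> 'w set \<Rightarrow> ('e \<Rightarrow> 'w \<Rightarrow> 'v) \<Rightarrow> bool" where
  "uniform_code E r n W Z \<longleftrightarrow> finite W \<and> W \<noteq> {} \<and> 2 \<le> n \<and>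
     (\<forall>A\<subseteq>E. \<forall>w\<in>W. card {v \<in> W. \<forall>e\<in>A. Z e v = Z e w} * n ^ r A = card W)"

lemma uniform_code_fibre_card:
  assumes "uniform_code E r n W Z" "A \<subseteq> E" "y \<in> joint_rv Z A ` W"
  shows "card {v \<in> W. joint_rv Z A v = y} * n ^ r A = card W"
  using assms by (auto simp: uniform_code_def joint_rv_eq_iff)

lemma uniform_code_card_image:
  assumes code: "uniform_code E r n W Z" and AE: "A \<subseteq> E"
  shows "card (joint_rv Z A ` W) = n ^ r A"
proof -
  have W: "finite W" "W \<noteq> {}"
    using code by (auto simp: uniform_code_def)
  have "card W = (\<Sum>y\<in>joint_rv Z A ` W. card {v \<in> W. joint_rv Z A v = y})"
    using sum.image_gen[OF W(1), of "\<lambda>_. 1::nat" "joint_rv Z A"] by simp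
  then have "card W * n ^ r A = (\<Sum>y\<in>joint_rv Z A ` W. card {v \<in> W. joint_rv Z A v = y} * n ^ r A)"
    by (simp add: sum_distrib_right)
  also have "\<dots> = card (joint_rv Z A ` W) * card W"
    using uniform_code_fibre_card[OF code AE] by simp
  finally show ?thesis
    using W by simp
qed

lemma uniform_code_fibre_prob:
  assumes code: "uniform_code E r n W Z" and "A \<subseteq> E" "y \<in> joint_rv Z A ` W"
  shows "measure (uniform_count_measure W) {w \<in> W. joint_rv Z A w = y} = 1 / real n ^ r A"
proof -
  have W: "finite W" "W \<noteq> {}" and n: "n > 0"
    using code by (auto simp: uniform_code_def)
  have "real (card {v \<in> W. joint_rv Z A v = y}) * real n ^ r A = real (card W)"
    using uniform_code_fibre_card[OF assms] by (metis of_nat_mult of_nat_power)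
  then show ?thesis
    using W n by (subst measure_uniform_count_measure) (auto simp: field_simps)
qed

text \<open>Under the uniform measure \<open>joint_rv Z A\<close> is uniform on
  \<open>n ^ r A\<close> values and has entropy \<open>r A * log 2 n\<close>, so the scaling factor
  is \<open>1 / log 2 n\<close>.\<close>

lemma uniform_code_imp_entropic:
  fixes W :: "'w set" and Z :: "'e \<Rightarrow> 'w \<Rightarrow> 'v"
  assumes code: "uniform_code E r n W Z"
  shows "entropic TYPE('w) TYPE('v) E r"
  unfolding entropic_def
proof (intro exI conjI allI impI)
  have W: "finite W" "W \<noteq> {}" and n: "n \<ge> 2"
    using code by (auto simp: uniform_code_def)
  show "prob_space (uniform_count_measure W)"
    using W by (rule prob_space_uniform_count_measure)
  show "\<forall>e\<in>E. discrete_rv (uniform_count_measure W) (Z e)"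
    using W by (auto simp: discrete_rv_def space_uniform_count_measure
        sets_uniform_count_measure measurable_def countable_finite)
  have log_pos: "log 2 n > 0"
    using n by simp
  then show "1 / log 2 n > 0"
    by simp
  fix A assume AE: "A \<subseteq> E"
  have "shannon_entropy (uniform_count_measure W) (joint_rv Z A) =
    (\<integral>\<^sup>+ x. ennreal (r A * log 2 n / real n ^ r A) \<partial>count_space (joint_rv Z A ` W))"
    unfolding shannon_entropy_def space_uniform_count_measure
  proof (intro nn_integral_cong)
    fix y assume "y \<in> space (count_space (joint_rv Z A ` W))"
    then have y: "measure (uniform_count_measure W) {w \<in> W. joint_rv Z A w = y} = 1 / real n ^ r A"
      using uniform_code_fibre_prob[OF code AE] by simp
    have "log 2 (1 / real n ^ r A) = - (r A * log 2 n)"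
      using n by (simp add: log_divide log_nat_power)
    then show "ennreal (- (measure (uniform_count_measure W) {w \<in> W. joint_rv Z A w = y} *
        log 2 (measure (uniform_count_measure W) {w \<in> W. joint_rv Z A w = y}))) =
      ennreal (r A * log 2 n / real n ^ r A)"
      unfolding y by simp
  qed
  also have "\<dots> = ennreal (r A * log 2 n / real n ^ r A) * of_nat (n ^ r A)"
    using W uniform_code_card_image[OF code AE] by (simp add: emeasure_count_space)
  also have "\<dots> = ennreal (r A * log 2 n / real n ^ r A * real (n ^ r A))"
    using log_pos by (simp add: ennreal_of_nat_eq_real_of_nat flip: ennreal_mult)
  also have "\<dots> = ennreal (r A * log 2 n)"
    using n by simp
  finally have "ennreal (1 / log 2 n) * shannon_entropy (uniform_count_measure W) (joint_rv Z A) =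
    ennreal (1 / log 2 n * (r A * log 2 n))"
    using log_pos by (simp flip: ennreal_mult)
  also have "\<dots> = of_nat (r A)"
    using log_pos by (simp add: ennreal_of_nat_eq_real_of_nat)
  finally show "of_nat (r A) =
    ennreal (1 / log 2 n) * shannon_entropy (uniform_count_measure W) (joint_rv Z A)" ..
qed

text \<open>Both sides have \<open>n ^ card A\<close> elements and one inclusion is clear, so on
  independent sets all combinations of values occur.\<close>

lemma uniform_code_indep_joint_surj:
  assumes code: "uniform_code E r n W Z" and M: "matroid E r" and A: "matroid_indep E r A"
  shows "joint_rv Z A ` W = (\<Pi>\<^sub>E e\<in>A. Z e ` W)"
proof (rule card_subset_eq)
  have W: "finite W"
    using code by (auto simp: uniform_code_def)
  have AE: "A \<subseteq> E" and rA: "r A = card A"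
    using A by (auto simp: matroid_indep_def)
  have finA: "finite A"
    using matroid_finite_subset[OF M AE] .
  show "finite (\<Pi>\<^sub>E e\<in>A. Z e ` W)"
    using finA W by (intro finite_PiE) auto
  show "joint_rv Z A ` W \<subseteq> (\<Pi>\<^sub>E e\<in>A. Z e ` W)"
    by (auto simp: joint_rv_def)
  have "card (Z e ` W) = n" if "e \<in> A" for e
  proof -
    have "matroid_indep E r {e}"
      using matroid_indep_mono[OF M A] that by simp
    then have "card (joint_rv Z {e} ` W) = n"
      using uniform_code_card_image[OF code, of "{e}"] by (simp add: matroid_indep_def)
    moreover have "inj_on (\<lambda>y. y e) (joint_rv Z {e} ` W)"
      by (auto simp: inj_on_def joint_rv_eq_iff) (auto simp: joint_rv_def)
    moreover have "(\<lambda>y. y e) ` joint_rv Z {e} ` W = Z e ` W"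
      by (simp add: image_image joint_rv_def)
    ultimately show ?thesis
      by (metis card_image)
  qed
  then show "card (joint_rv Z A ` W) = card (\<Pi>\<^sub>E e\<in>A. Z e ` W)"
    using uniform_code_card_image[OF code AE] finA rA by (simp add: card_PiE)
qed

text \<open>By surjectivity the event splits into one nonempty fibre for each admissible tuple.
  Every fibre has probability \<open>1 / n ^ card A\<close>, and the number of tuples is a
  product.\<close>

lemma uniform_code_indep_prob:
  assumes code: "uniform_code E r n W Z" and M: "matroid E r" and A: "matroid_indep E r A"
  shows "measure (uniform_count_measure W) {w \<in> W. \<forall>e\<in>A. Z e w \<in> S e} =
    (\<Prod>e\<in>A. real (card (Z e ` W \<inter> S e)) / n)"
proof -
  let ?T = "\<Pi>\<^sub>E e\<in>A. Z e ` W \<inter> S e"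
  have W: "finite W" "W \<noteq> {}" and n: "n > 0"
    using code by (auto simp: uniform_code_def)
  have AE: "A \<subseteq> E" and rA: "r A = card A"
    using A by (auto simp: matroid_indep_def)
  have finA: "finite A"
    using matroid_finite_subset[OF M AE] .
  interpret prob_space "uniform_count_measure W"
    using W by (rule prob_space_uniform_count_measure)
  have finT: "finite ?T"
    using finA W by (intro finite_PiE) auto
  have T: "?T \<subseteq> joint_rv Z A ` W"
    unfolding uniform_code_indep_joint_surj[OF assms] by (rule PiE_mono) auto
  have "{w \<in> W. \<forall>e\<in>A. Z e w \<in> S e} = (\<Union>y\<in>?T. {w \<in> W. joint_rv Z A w = y})"
  proof (intro equalityI subsetI)
    fix w assume "w \<in> {w \<in> W. \<forall>e\<in>A. Z e w \<in> S e}"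
    then have "w \<in> W" "joint_rv Z A w \<in> ?T"
      by (auto simp: joint_rv_def)
    then show "w \<in> (\<Union>y\<in>?T. {w \<in> W. joint_rv Z A w = y})"
      by blast
  next
    fix w assume "w \<in> (\<Union>y\<in>?T. {w \<in> W. joint_rv Z A w = y})"
    then have w: "w \<in> W" "joint_rv Z A w \<in> ?T"
      by auto
    have "Z e w \<in> S e" if "e \<in> A" for e
      using PiE_mem[OF w(2) that] that by (simp add: joint_rv_def)
    with w show "w \<in> {w \<in> W. \<forall>e\<in>A. Z e w \<in> S e}"
      by auto
  qed
  then have "measure (uniform_count_measure W) {w \<in> W. \<forall>e\<in>A. Z e w \<in> S e} =
    measure (uniform_count_measure W) (\<Union>y\<in>?T. {w \<in> W. joint_rv Z A w = y})"
    by simp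
  also have "\<dots> = (\<Sum>y\<in>?T. measure (uniform_count_measure W) {w \<in> W. joint_rv Z A w = y})"
    using finT by (intro finite_measure_finite_Union)
      (auto simp: sets_uniform_count_measure disjoint_family_on_def)
  also have "\<dots> = (\<Sum>y\<in>?T. 1 / real n ^ card A)"
    using uniform_code_fibre_prob[OF code AE subsetD[OF T]] rA by (intro sum.cong) auto
  also have "\<dots> = (\<Prod>e\<in>A. real (card (Z e ` W \<inter> S e)) / n)"
    using finA by (simp add: card_PiE prod_dividef)
  finally show ?thesis .
qed

text \<open>The value spaces are the finite sets of attained values with all subsets measurable, and
  so are their finite products; measurability of the maps is then automatic.\<close>

lemma uniform_code_imp_representation:
  fixes W :: "'w set" and Z :: "'e \<Rightarrow> 'w \<Rightarrow> 'v"
  assumes code: "uniform_code E r n W Z" and M: "matroid E r"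
  shows "prob_space_representation E r (uniform_count_measure W) (\<lambda>e. count_space (Z e ` W)) Z"
    and "nonzero_singletons (uniform_count_measure W)"
proof -
  let ?P = "uniform_count_measure W" and ?N = "\<lambda>e. count_space (Z e ` W)"
  have W: "finite W" "W \<noteq> {}" and n: "n \<ge> 2"
    using code by (auto simp: uniform_code_def)
  interpret prob_space ?P
    using W by (rule prob_space_uniform_count_measure)
  have meas: "Z e \<in> measurable ?P (?N e)" for e
    by (auto simp: measurable_def space_uniform_count_measure sets_uniform_count_measure)
  show "nonzero_singletons ?P"
    using W by (simp add: nonzero_singletons_def space_uniform_count_measure measure_uniform_count_measure)
  have "discrete_prob_space ?P"
    using W by (simp add: discrete_prob_space_def space_uniform_count_measure sets_uniform_count_measure
        prob_space_axioms countable_finite)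
  moreover have "indep_vars ?N Z A" if A: "matroid_indep E r A" for A
    unfolding indep_vars_def2 indep_sets_def
  proof (intro conjI ballI allI impI)
    fix J F assume J: "J \<subseteq> A" "J \<noteq> {}" "finite J"
      and F: "F \<in> (\<Pi> j\<in>J. {Z j -` S \<inter> space ?P |S. S \<in> sets (?N j)})"
    have "\<forall>j\<in>J. \<exists>S. F j = Z j -` S \<inter> space ?P"
      using Pi_mem[OF F] by blast
    then obtain S where S: "\<And>j. j \<in> J \<Longrightarrow> F j = Z j -` S j \<inter> W"
      by (metis space_uniform_count_measure)
    have ind: "matroid_indep E r B" if "B \<subseteq> J" for B
      using matroid_indep_mono[OF M A] J that by auto
    have "(\<Inter>j\<in>J. F j) = {w \<in> W. \<forall>e\<in>J. Z e w \<in> S e}"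
      using S J by auto
    then have "prob (\<Inter>j\<in>J. F j) = (\<Prod>e\<in>J. real (card (Z e ` W \<inter> S e)) / n)"
      using uniform_code_indep_prob[OF code M ind[of J]] by simp
    also have "\<dots> = (\<Prod>j\<in>J. prob (F j))"
    proof (intro prod.cong refl)
      fix e assume "e \<in> J"
      then have "F e = {w \<in> W. \<forall>e\<in>{e}. Z e w \<in> S e}"
        using S by auto
      then show "real (card (Z e ` W \<inter> S e)) / n = prob (F e)"
        using uniform_code_indep_prob[OF code M ind[of "{e}"]] \<open>e \<in> J\<close> by simp
    qed
    finally show "prob (\<Inter>j\<in>J. F j) = (\<Prod>j\<in>J. prob (F j))" .
  qed (use meas in \<open>auto simp: sets_uniform_count_measure space_uniform_count_measure\<close>)
  moreover have "\<exists>f \<in> measurable (PiM (C - {c}) ?N) (?N c).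
      \<forall>\<omega>\<in>space ?P. f (joint_rv Z (C - {c}) \<omega>) = Z c \<omega>"
    if C: "matroid_circuit E r C" and c: "c \<in> C" for C c
  proof -
    have CE: "C \<subseteq> E" "C - {c} \<subseteq> E"
      using C by (auto simp: matroid_circuit_def)
    \<comment> \<open>Fibres over \<open>C\<close> and over \<open>C - {c}\<close> have the same
      size because the ranks agree; being nested, they coincide.\<close>
    have det: "Z c v = Z c w" if vw: "v \<in> W" "w \<in> W" "joint_rv Z (C - {c}) v = joint_rv Z (C - {c}) w" for v w
    proof -
      let ?F = "\<lambda>A. {v \<in> W. \<forall>e\<in>A. Z e v = Z e w}"
      have "card (?F C) * n ^ r C = card W" "card (?F (C - {c})) * n ^ r (C - {c}) = card W"
        using code CE vw(2) unfolding uniform_code_def by simp_all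
      then have "card (?F C) * n ^ r C = card (?F (C - {c})) * n ^ r C"
        using matroid_circuit_rank[OF M C c] by simp
      then have "card (?F C) = card (?F (C - {c}))"
        using n by simp
      then have "?F C = ?F (C - {c})"
        using W by (intro card_subset_eq) auto
      moreover have "v \<in> ?F (C - {c})"
        using vw by (auto simp: joint_rv_eq_iff)
      ultimately show ?thesis
        using c by blast
    qed
    obtain w0 where w0: "w0 \<in> W"
      using W by auto
    \<comment> \<open>An attained tuple is sent to the value at any word above it, well defined by
      \<open>det\<close>. The default \<open>Z c w0\<close> keeps \<open>f\<close> inside the value
      space on all other tuples.\<close>
    define f where "f y = (if \<exists>w\<in>W. joint_rv Z (C - {c}) w = y
      then Z c (SOME w. w \<in> W \<and> joint_rv Z (C - {c}) w = y) else Z c w0)" for y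
    have some: "(SOME w. w \<in> W \<and> joint_rv Z (C - {c}) w = y) \<in> W"
      "joint_rv Z (C - {c}) (SOME w. w \<in> W \<and> joint_rv Z (C - {c}) w = y) = y"
      if "w \<in> W" "joint_rv Z (C - {c}) w = y" for w y
      using someI[of "\<lambda>w. w \<in> W \<and> joint_rv Z (C - {c}) w = y" w] that by auto
    have "finite (C - {c})"
      using matroid_finite_subset[OF M CE(2)] .
    then have "PiM (C - {c}) ?N = count_space (\<Pi>\<^sub>E e\<in>C - {c}. Z e ` W)"
      using W by (intro count_space_PiM_finite) (auto intro: countable_finite)
    moreover have "f y \<in> Z c ` W" for y
      unfolding f_def using some(1) w0 by auto
    ultimately have "f \<in> measurable (PiM (C - {c}) ?N) (?N c)"
      by simp
    moreover have "f (joint_rv Z (C - {c}) w) = Z c w" if "w \<in> W" for w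
    proof -
      have "f (joint_rv Z (C - {c}) w) = Z c (SOME v. v \<in> W \<and> joint_rv Z (C - {c}) v = joint_rv Z (C - {c}) w)"
        unfolding f_def using that by auto
      also have "\<dots> = Z c w"
        using some[OF that refl] that by (intro det)
      finally show ?thesis .
    qed
    ultimately show ?thesis
      unfolding space_uniform_count_measure by blast
  qed
  moreover have "\<exists>S\<in>sets (?N e). \<exists>T\<in>sets (?N e). S \<subset> space (?N e) \<and> T \<subset> space (?N e) \<and> S \<inter> T = {} \<and>
      prob (Z e -` S \<inter> space ?P) \<noteq> 0 \<and> prob (Z e -` T \<inter> space ?P) \<noteq> 0"
    if e: "e \<in> E" "\<not> matroid_loop E r e" for e
  proof -
    have "matroid_indep E r {}"
      using matroid_rank_empty[OF M] by (simp add: matroid_indep_def)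
    then have "matroid_indep E r {e}"
      using e by (auto simp: matroid_loop_def matroid_circuit_def subset_singleton_iff psubset_eq)
    then have "card (joint_rv Z {e} ` W) = n"
      using uniform_code_card_image[OF code, of "{e}"] by (simp add: matroid_indep_def)
    then have "\<not> joint_rv Z {e} ` W \<subseteq> {joint_rv Z {e} v}" for v
      using n card_mono[of "{joint_rv Z {e} v}" "joint_rv Z {e} ` W"] by auto
    moreover obtain v where v: "v \<in> W"
      using W(2) by auto
    ultimately obtain w where w: "w \<in> W" "joint_rv Z {e} w \<noteq> joint_rv Z {e} v"
      unfolding image_subset_iff by auto
    then have vw: "v \<in> W" "w \<in> W" "Z e v \<noteq> Z e w"
      using v by (auto simp: joint_rv_eq_iff)
    have nz: "prob (Z e -` {Z e u} \<inter> space ?P) \<noteq> 0" if "u \<in> W" for u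
    proof -
      have "u \<in> Z e -` {Z e u} \<inter> W"
        using that by simp
      then have "card (Z e -` {Z e u} \<inter> W) \<noteq> 0"
        using W(1) by (metis card_0_eq empty_iff finite_Int)
      then show ?thesis
        using W by (simp add: space_uniform_count_measure measure_uniform_count_measure)
    qed
    show ?thesis
    proof (intro bexI conjI)
      have "Z e v \<in> Z e ` W" "Z e w \<in> Z e ` W"
        using vw by auto
      then show "{Z e v} \<subset> space (?N e)" "{Z e w} \<subset> space (?N e)"
        using vw(3) unfolding space_count_space by (metis empty_subsetI insert_subset psubsetI singleton_iff)+
      show "{Z e v} \<inter> {Z e w} = {}"
        using vw(3) by simp
    qed (use vw nz in auto)
  qed
  ultimately show "prob_space_representation E r ?P ?N Z"
    unfolding prob_space_representation_def using meas by simp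
qed

section \<open>Realization over arbitrary infinite types\<close>

lemma inj_on_infinite_type:
  fixes S :: "'a set"
  assumes "finite S"
  obtains h :: "'a \<Rightarrow> 'b::infinite" where "inj_on h S"
proof -
  obtain F :: "'b set" where "finite F" "card F = card S"
    using infinite_arbitrarily_large[OF infinite_UNIV] by metis
  then obtain h where "bij_betw h S F"
    using finite_same_card_bij[OF assms] by metis
  then show thesis
    using that bij_betw_imp_inj_on by blast
qed

text \<open>The support of \<open>p\<close> is itself the code. Its points and their symbols are
  finite in number, so injections \<open>h\<close> and \<open>g\<close> carry them into any infinite
  types.\<close>

lemma pmf_uniform_model_imp_uniform_code:
  fixes p :: "('e \<Rightarrow> 'v) pmf"
  assumes model: "pmf_uniform_model E r n p" and ext: "set_pmf p \<subseteq> extensional E" and E: "finite E"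
  obtains W :: "'c::infinite set" and Z :: "'e \<Rightarrow> 'c \<Rightarrow> 'd::infinite" where "uniform_code E r n W Z"
proof -
  let ?S = "set_pmf p"
  have n: "2 \<le> n" and prob: "\<And>A x. A \<subseteq> E \<Longrightarrow> x \<in> ?S \<Longrightarrow> measure_pmf.prob p (cylinder A x) = 1 / real n ^ r A"
    using model by (auto simp: pmf_uniform_model_def)
  have "pmf p x = 1 / real n ^ r E" if x: "x \<in> ?S" for x
  proof -
    \<comment> \<open>Support points are extensional on \<open>E\<close>, so a cylinder over all of
      \<open>E\<close> contains only one of them.\<close>
    have "pmf p x = measure_pmf.prob p (cylinder E x)"
      unfolding measure_pmf_single[symmetric] using x ext
      by (intro measure_pmf_cong_support) (auto simp: cylinder_def intro: extensionalityI)
    then show ?thesis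
      using prob[OF _ x] by simp
  qed
  note unif = this pmf_constant_uniform[OF this]
  have count: "card {y \<in> ?S. \<forall>e\<in>A. y e = x e} * n ^ r A = card ?S" if A: "A \<subseteq> E" and x: "x \<in> ?S" for A x
  proof -
    have "1 / real n ^ r A = measure_pmf.prob p (cylinder A x \<inter> ?S)"
      using prob[OF A x] by (simp add: measure_Int_set_pmf)
    also have "cylinder A x \<inter> ?S = {y \<in> ?S. \<forall>e\<in>A. y e = x e}"
      by (auto simp: cylinder_def)
    also have "measure_pmf.prob p \<dots> = (\<Sum>y\<in>{y \<in> ?S. \<forall>e\<in>A. y e = x e}. 1 / card ?S)"
      using unif by (subst measure_measure_pmf_finite) (auto intro!: sum.cong)
    also have "\<dots> = card {y \<in> ?S. \<forall>e\<in>A. y e = x e} / card ?S"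
      by simp
    finally have "real (card {y \<in> ?S. \<forall>e\<in>A. y e = x e} * n ^ r A) = real (card ?S)"
      using n unif(2) x by (auto simp: field_simps)
    then show ?thesis
      using of_nat_eq_iff by blast
  qed
  obtain h :: "('e \<Rightarrow> 'v) \<Rightarrow> 'c" where h: "inj_on h ?S"
    using inj_on_infinite_type[OF unif(2)] .
  have "finite (\<Union>x\<in>?S. x ` E)"
    using unif(2) E by auto
  then obtain g :: "'v \<Rightarrow> 'd" where g: "inj_on g (\<Union>x\<in>?S. x ` E)"
    using inj_on_infinite_type by metis
  define Z where "Z e w = g (inv_into ?S h w e)" for e w
  have Zh: "Z e (h x) = g (x e)" if "x \<in> ?S" for e x
    using h that by (simp add: Z_def)
  have Z_eq: "Z e (h y) = Z e (h x) \<longleftrightarrow> y e = x e" if "x \<in> ?S" "y \<in> ?S" "e \<in> E" for e x y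
    using that g by (auto simp: Zh dest!: inj_onD)
  have "card {v \<in> h ` ?S. \<forall>e\<in>A. Z e v = Z e w} * n ^ r A = card (h ` ?S)"
    if A: "A \<subseteq> E" and w: "w \<in> h ` ?S" for A w
  proof -
    obtain x where x: "x \<in> ?S" "w = h x"
      using w by auto
    have "{v \<in> h ` ?S. \<forall>e\<in>A. Z e v = Z e w} = h ` {y \<in> ?S. \<forall>e\<in>A. y e = x e}"
      using x Z_eq A by (auto simp: subset_iff)
    moreover have "inj_on h {y \<in> ?S. \<forall>e\<in>A. y e = x e}"
      using h by (rule inj_on_subset) auto
    ultimately show ?thesis
      using count[OF A x(1)] h by (simp add: card_image)
  qed
  then have "uniform_code E r n (h ` ?S) Z"
    using unif(2) n set_pmf_not_empty[of p] by (simp add: uniform_code_def)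
  then show thesis
    using that by blast
qed

text \<open>The types of sample points and values on the two sides are unrelated: either structure
  yields a finite code, which is rebuilt in the types of the other.\<close>

theorem theorem4p4:
  fixes E :: "'e set" and r :: "'e set \<Rightarrow> nat"
  assumes "matroid E r" and "matroid_connected E r" and "r E \<ge> 2"
  shows "(entropic TYPE('a::infinite) TYPE('b::infinite) E r \<longleftrightarrow>
            (\<exists>(P :: ('c::infinite) measure) (N :: 'e \<Rightarrow> ('d::infinite) measure) X.
               prob_space_representation E r P N X \<and> nonzero_singletons P)) \<and>
         (\<forall>(P :: 'w measure) (N :: 'e \<Rightarrow> 'v measure) X.
            prob_space_representation E r P N X \<and> nonzero_singletons P \<longrightarrow>
            (\<forall>e\<in>E. uniformly_distributed P (N e) (X e))) \<and>
         (entropic TYPE('a) TYPE('b) E r \<longrightarrow>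
            (\<exists>(P :: 'c measure) (N :: 'e \<Rightarrow> 'd measure) X.
               prob_space_representation E r P N X \<and> nonzero_singletons P \<and> finite (space P)))"
proof -
  note M = assms
  have ind: "matroid_indep E r {e}" if "e \<in> E" for e
    using connected_matroid_singleton_indep[OF M that] .
  then have nl: "\<not> matroid_loop E r e" if "e \<in> E" for e
    using that by (auto simp: matroid_loop_def matroid_circuit_def)
  have finE: "finite E"
    using matroid_finite_subset[OF M(1)] by simp
  have fwd: "\<exists>(P :: 'c measure) (N :: 'e \<Rightarrow> 'd measure) X.
      prob_space_representation E r P N X \<and> nonzero_singletons P \<and> finite (space P)"
    if ent: "entropic TYPE('a) TYPE('b) E r"
  proof -
    obtain p :: "('e \<Rightarrow> 'b) pmf" where p: "pmf_representation E r p" "set_pmf p \<subseteq> extensional E"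
      using entropic_imp_pmf_representation[OF ent M(1) ind] .
    obtain n where n: "pmf_uniform_model E r n p"
      using connected_pmf_representation_uniform[OF M p(1)] .
    obtain W :: "'c set" and Z :: "'e \<Rightarrow> 'c \<Rightarrow> 'd" where code: "uniform_code E r n W Z"
      using pmf_uniform_model_imp_uniform_code[OF n p(2) finE] .
    then have "finite (space (uniform_count_measure W))"
      by (simp add: uniform_code_def space_uniform_count_measure)
    with uniform_code_imp_representation[OF code M(1)] show ?thesis
      by blast
  qed
  \<comment> \<open>The intermediate mass function takes atoms as values; re-encoding its support as
    a code moves it to the value type of the entropic structure.\<close>
  have "entropic TYPE('a) TYPE('b) E r"
    if R: "prob_space_representation E r P N X" "nonzero_singletons P"
    for P :: "'c measure" and N :: "'e \<Rightarrow> 'd measure" and X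
  proof -
    let ?J = "joint_rv (\<lambda>e \<omega>. atom_of (N e) (X e \<omega>)) E"
    obtain p where p: "pmf_representation E r p" "set_pmf p = ?J ` space P"
      "\<forall>S. measure_pmf.prob p S = measure P {\<omega> \<in> space P. ?J \<omega> \<in> S}"
      using representation_imp_pmf_representation[OF R M(1) nl] .
    have ext: "set_pmf p \<subseteq> extensional E"
      unfolding p(2) by (auto simp: joint_rv_def)
    obtain n where n: "pmf_uniform_model E r n p"
      using connected_pmf_representation_uniform[OF M p(1)] .
    obtain W :: "'a set" and Z :: "'e \<Rightarrow> 'a \<Rightarrow> 'b" where "uniform_code E r n W Z"
      using pmf_uniform_model_imp_uniform_code[OF n ext finE] .
    then show ?thesis
      by (rule uniform_code_imp_entropic)
  qed
  then show ?thesis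
    using fwd representation_uniformly_distributed[OF _ _ M] by metis
qed

end
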